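(* Let $\mathcal{A}$ be a Grothendieck category and let $\mathbf{F}=(F,\delta,\xi)$ be a comonad in $\mathcal{A}$ whose underlying functor $F:\mathcal{A}\to\mathcal{A}$ preserves cokernels and commutes with direct sums. The following are equivalent: (i) the forgetful functor $\mathbf{S}:\mathcal{A}^{\mathbf{F}}\to\mathcal{A}$ is a separable functor; (ii) the forgetful functor $\mathscr{S}:{}^{\mathbf{F}}\mathcal{M}^{\mathbf{F}}\to{}_{\mathcal{A}}\mathcal{M}^{\mathbf{F}}$ is a Maschke functor; (iii) $\delta:(F,\delta,\delta)\to(F^2,\delta_F,F\delta)$ is a split monomorphism in the category ${}^{\mathbf{F}}\mathcal{M}^{\mathbf{F}}$.
   Context: Functors are additive. A comonad $\mathbf F=(F,\delta,\xi)$ in $\mathcal A$ is an endofunctor $F$ with natural transformations $\delta:F\to F^2$, $\xi:F\to \mathrm{id}_{\mathcal A}$ such that $\delta_F\circ\delta=F\delta\circ\delta$ and $F\xi\circ\delta=\xi_F\circ\delta=F$ (an object or functor also denotes its identity). For a natural transformation $\beta$ and functors $H,I$, $\beta_I$ has components $\beta_{I(Z)}$ and $H\beta$ has components $H(\beta_X)$. $\overline{\mathrm{Funt}}(\mathcal A,\mathcal A)$ is the category of additive functors $\mathcal A\to\mathcal A$ that preserve cokernels and commute with direct sums, with natural transformations as morphisms. $\mathcal A^{\mathbf F}$: objects are pairs $(X,d^X)$ with $X\in\mathcal A$ and $d^X:X\to F(X)$ satisfying $\delta_X\circ d^X=F(d^X)\circ d^X$, $\xi_X\circ d^X=X$; morphisms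 $(X,d^X)\to(X',d^{X'})$ are morphisms $f:X\to X'$ in $\mathcal A$ with $d^{X'}\circ f=F(f)\circ d^X$. $\mathbf S(X,d^X)=X$. ${}_{\mathcal A}\mathcal M^{\mathbf F}$: objects are pairs $(\mathsf M,\mathfrak m)$ with $\mathsf M\in\overline{\mathrm{Funt}}(\mathcal A,\mathcal A)$ and $\mathfrak m:\mathsf M\to F\mathsf M$ natural with $\delta_{\mathsf M}\circ\mathfrak m=F\mathfrak m\circ\mathfrak m$, $\xi_{\mathsf M}\circ\mathfrak m=\mathsf M$; morphisms are natural transformations $f:\mathsf M\to\mathsf M'$ with $\mathfrak m'\circ f=Ff\circ\mathfrak m$. ${}^{\mathbf F}\mathcal M^{\mathbf F}$ ($\mathbf F$-bicomodules): objects are triples $(\mathsf M,\mathfrak m,\mathfrak n)$ with $(\mathsf M,\mathfrak m)\in{}_{\mathcal A}\mathcal M^{\mathbf F}$ and $\mathfrak n:\mathsf M\to\mathsf MF$ natural with $\mathsf M\delta\circ\mathfrak n=\mathfrak n_F\circ\mathfrak n$, $\mathsf M\xi\circ\mathfrak n=\mathsf M$ and $\mathfrak m_F\circ\mathfrak n=F\mathfrak n\circ\mathfrak m$; morphisms are natural transformations $f:\mathsf M\to\mathsf M'$ with $\mathfrak m'\circ f=Ff\circ\mathfrak m$ and $\mathfrak n'\circ f=f_F\circ\mathfrak n$. $\mathscr S(\mathsf M,\mathfrak m,\mathfrak n)=(\mathsf M,\mathfrak m)$. A functor $\mathcal F:\mathscr A\to\mathscr B$ is separable if the natural transformation $\mathrm{Hom}_{\mathscr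 A}(-,-)\to\mathrm{Hom}_{\mathscr B}(\mathcal F(-),\mathcal F(-))$, $f\mapsto\mathcal F(f)$, of functors $\mathscr A^{op}\times\mathscr A\to\mathrm{Set}$ has a natural left inverse. An object $M\in\mathscr A$ is $\mathcal F$-injective if for every $i:X\to X'$ in $\mathscr A$ such that $\mathcal F(i)$ has a left inverse in $\mathscr B$ and every $f:X\to M$ there is $g:X'\to M$ with $g\circ i=f$. $\mathcal F$ is a Maschke functor if every object of $\mathscr A$ is $\mathcal F$-injective. *)

theory Defs
  imports "HOL-Algebra.Group" "HOL-Library.FuncSet"
begin

unbundle cardinal_syntax

section \<open>Categories\<close>

record ('o, 'a) cat =
  Obj :: "'o set"
  Arr :: "'a set"
  Dom :: "'a \<Rightarrow> 'o"
  Cod :: "'a \<Rightarrow> 'o"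
  Ide :: "'o \<Rightarrow> 'a"
  Comp :: "'a \<Rightarrow> 'a \<Rightarrow> 'a"  (infixr \<open>\<cdot>\<index>\<close> 70)

definition hom_set :: "('o, 'a, 'z) cat_scheme \<Rightarrow> 'o \<Rightarrow> 'o \<Rightarrow> 'a set" where
  "hom_set C X Y = {f \<in> Arr C. Dom C f = X \<and> Cod C f = Y}"

locale category =
  fixes C :: "('o, 'a, 'z) cat_scheme" (structure)
  assumes dom_obj: "f \<in> Arr C \<Longrightarrow> Dom C f \<in> Obj C"
    and cod_obj: "f \<in> Arr C \<Longrightarrow> Cod C f \<in> Obj C"
    and ide_hom: "X \<in> Obj C \<Longrightarrow> Ide C X \<in> hom_set C X X"
    and comp_hom: "\<lbrakk>f \<in> hom_set C X Y; g \<in> hom_set C Y Z\<rbrakk> \<Longrightarrow> g \<cdot> f \<in> hom_set C X Z"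
    and comp_ide: "f \<in> hom_set C X Y \<Longrightarrow> f \<cdot> Ide C X = f"
    and ide_comp: "f \<in> hom_set C X Y \<Longrightarrow> Ide C Y \<cdot> f = f"
    and comp_assoc: "\<lbrakk>f \<in> hom_set C X Y; g \<in> hom_set C Y Z; h \<in> hom_set C Z W\<rbrakk>
      \<Longrightarrow> (h \<cdot> g) \<cdot> f = h \<cdot> (g \<cdot> f)"

definition mono :: "('o, 'a, 'z) cat_scheme \<Rightarrow> 'a \<Rightarrow> bool" where
  "mono C f \<longleftrightarrow> f \<in> Arr C \<and>
    (\<forall>X\<in>Obj C. \<forall>g\<in>hom_set C X (Dom C f). \<forall>h\<in>hom_set C X (Dom C f).
      f \<cdot>\<^bsub>C\<^esub> g = f \<cdot>\<^bsub>C\<^esub> h \<longrightarrow> g = h)"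

definition epi :: "('o, 'a, 'z) cat_scheme \<Rightarrow> 'a \<Rightarrow> bool" where
  "epi C f \<longleftrightarrow> f \<in> Arr C \<and>
    (\<forall>X\<in>Obj C. \<forall>g\<in>hom_set C (Cod C f) X. \<forall>h\<in>hom_set C (Cod C f) X.
      g \<cdot>\<^bsub>C\<^esub> f = h \<cdot>\<^bsub>C\<^esub> f \<longrightarrow> g = h)"

definition split_mono :: "('o, 'a, 'z) cat_scheme \<Rightarrow> 'a \<Rightarrow> bool" where
  "split_mono C f \<longleftrightarrow> f \<in> Arr C \<and>
    (\<exists>g\<in>hom_set C (Cod C f) (Dom C f). g \<cdot>\<^bsub>C\<^esub> f = Ide C (Dom C f))"

definition is_coproduct ::
  "('o, 'a, 'z) cat_scheme \<Rightarrow> 'i set \<Rightarrow> ('i \<Rightarrow> 'o) \<Rightarrow> 'o \<Rightarrow> ('i \<Rightarrow> 'a) \<Rightarrow> bool" where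
  "is_coproduct C I X S \<iota> \<longleftrightarrow> S \<in> Obj C \<and> (\<forall>i\<in>I. \<iota> i \<in> hom_set C (X i) S) \<and>
    (\<forall>Y\<in>Obj C. \<forall>f. (\<forall>i\<in>I. f i \<in> hom_set C (X i) Y) \<longrightarrow>
      (\<exists>!u. u \<in> hom_set C S Y \<and> (\<forall>i\<in>I. u \<cdot>\<^bsub>C\<^esub> \<iota> i = f i)))"

text \<open>A direct system is indexed by a directed preordered set \<open>(I, r)\<close>, where \<open>(i, j) \<in> r\<close> means
  \<open>i \<le> j\<close>, and has transition arrows \<open>t i j : X i \<rightarrow> X j\<close>.\<close>

definition directed_preorder :: "'i set \<Rightarrow> 'i rel \<Rightarrow> bool" where
  "directed_preorder I r \<longleftrightarrow> I \<noteq> {} \<and> preorder_on I r \<and>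
    (\<forall>i\<in>I. \<forall>j\<in>I. \<exists>k\<in>I. (i, k) \<in> r \<and> (j, k) \<in> r)"

definition direct_system ::
  "('o, 'a, 'z) cat_scheme \<Rightarrow> 'i set \<Rightarrow> 'i rel \<Rightarrow> ('i \<Rightarrow> 'o) \<Rightarrow> ('i \<Rightarrow> 'i \<Rightarrow> 'a) \<Rightarrow> bool" where
  "direct_system C I r X t \<longleftrightarrow> (\<forall>i\<in>I. X i \<in> Obj C \<and> t i i = Ide C (X i)) \<and>
    (\<forall>i j. (i, j) \<in> r \<longrightarrow> t i j \<in> hom_set C (X i) (X j)) \<and>
    (\<forall>i j k. (i, j) \<in> r \<and> (j, k) \<in> r \<longrightarrow> t j k \<cdot>\<^bsub>C\<^esub> t i j = t i k)"

definition direct_system_map ::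
  "('o, 'a, 'z) cat_scheme \<Rightarrow> 'i set \<Rightarrow> 'i rel \<Rightarrow> ('i \<Rightarrow> 'o) \<Rightarrow> ('i \<Rightarrow> 'i \<Rightarrow> 'a) \<Rightarrow>
    ('i \<Rightarrow> 'o) \<Rightarrow> ('i \<Rightarrow> 'i \<Rightarrow> 'a) \<Rightarrow> ('i \<Rightarrow> 'a) \<Rightarrow> bool" where
  "direct_system_map C I r X t X' t' f \<longleftrightarrow> (\<forall>i\<in>I. f i \<in> hom_set C (X i) (X' i)) \<and>
    (\<forall>i j. (i, j) \<in> r \<longrightarrow> f j \<cdot>\<^bsub>C\<^esub> t i j = t' i j \<cdot>\<^bsub>C\<^esub> f i)"

definition is_direct_limit ::
  "('o, 'a, 'z) cat_scheme \<Rightarrow> 'i set \<Rightarrow> 'i rel \<Rightarrow> ('i \<Rightarrow> 'o) \<Rightarrow> ('i \<Rightarrow> 'i \<Rightarrow> 'a) \<Rightarrow>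
    'o \<Rightarrow> ('i \<Rightarrow> 'a) \<Rightarrow> bool" where
  "is_direct_limit C I r X t L c \<longleftrightarrow> L \<in> Obj C \<and> (\<forall>i\<in>I. c i \<in> hom_set C (X i) L) \<and>
    (\<forall>i j. (i, j) \<in> r \<longrightarrow> c j \<cdot>\<^bsub>C\<^esub> t i j = c i) \<and>
    (\<forall>Y\<in>Obj C. \<forall>f. (\<forall>i\<in>I. f i \<in> hom_set C (X i) Y) \<and>
        (\<forall>i j. (i, j) \<in> r \<longrightarrow> f j \<cdot>\<^bsub>C\<^esub> t i j = f i) \<longrightarrow>
      (\<exists>!u. u \<in> hom_set C L Y \<and> (\<forall>i\<in>I. u \<cdot>\<^bsub>C\<^esub> c i = f i)))"

definition is_generator :: "('o, 'a, 'z) cat_scheme \<Rightarrow> 'o \<Rightarrow> bool" where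
  "is_generator C G \<longleftrightarrow> G \<in> Obj C \<and>
    (\<forall>X\<in>Obj C. \<forall>Y\<in>Obj C. \<forall>f\<in>hom_set C X Y. \<forall>g\<in>hom_set C X Y.
      f \<noteq> g \<longrightarrow> (\<exists>h\<in>hom_set C G X. f \<cdot>\<^bsub>C\<^esub> h \<noteq> g \<cdot>\<^bsub>C\<^esub> h))"


section \<open>Additive, abelian and Grothendieck categories\<close>

record ('o, 'a) addcat = "('o, 'a) cat" +
  Plus :: "'a \<Rightarrow> 'a \<Rightarrow> 'a"  (infixl \<open>\<boxplus>\<index>\<close> 65)
  Zero :: "'o \<Rightarrow> 'o \<Rightarrow> 'a"

definition hom_group :: "('o, 'a, 'z) addcat_scheme \<Rightarrow> 'o \<Rightarrow> 'o \<Rightarrow> 'a monoid" where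
  "hom_group C X Y = \<lparr>carrier = hom_set C X Y, monoid.mult = Plus C, one = Zero C X Y\<rparr>"

definition is_kernel :: "('o, 'a, 'z) addcat_scheme \<Rightarrow> 'a \<Rightarrow> 'a \<Rightarrow> bool" where
  "is_kernel C f k \<longleftrightarrow> f \<in> Arr C \<and> k \<in> Arr C \<and> Cod C k = Dom C f \<and>
    f \<cdot>\<^bsub>C\<^esub> k = Zero C (Dom C k) (Cod C f) \<and>
    (\<forall>X\<in>Obj C. \<forall>h\<in>hom_set C X (Dom C f). f \<cdot>\<^bsub>C\<^esub> h = Zero C X (Cod C f) \<longrightarrow>
      (\<exists>!u. u \<in> hom_set C X (Dom C k) \<and> k \<cdot>\<^bsub>C\<^esub> u = h))"

definition is_cokernel :: "('o, 'a, 'z) addcat_scheme \<Rightarrow> 'a \<Rightarrow> 'a \<Rightarrow> bool" where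
  "is_cokernel C f c \<longleftrightarrow> f \<in> Arr C \<and> c \<in> Arr C \<and> Dom C c = Cod C f \<and>
    c \<cdot>\<^bsub>C\<^esub> f = Zero C (Dom C f) (Cod C c) \<and>
    (\<forall>X\<in>Obj C. \<forall>h\<in>hom_set C (Cod C f) X. h \<cdot>\<^bsub>C\<^esub> f = Zero C (Dom C f) X \<longrightarrow>
      (\<exists>!u. u \<in> hom_set C (Cod C c) X \<and> u \<cdot>\<^bsub>C\<^esub> c = h))"

text \<open>Exactness of \<open>0 \<rightarrow> \<cdot> \<rightarrow> \<cdot> \<rightarrow> \<cdot> \<rightarrow> 0\<close> with the inner arrows \<open>f\<close>, \<open>g\<close>.\<close>

definition short_exact :: "('o, 'a, 'z) addcat_scheme \<Rightarrow> 'a \<Rightarrow> 'a \<Rightarrow> bool" where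
  "short_exact C f g \<longleftrightarrow> is_kernel C g f \<and> is_cokernel C f g"

locale preadditive_category = category C
  for C :: "('o, 'a, 'z) addcat_scheme" (structure) +
  assumes hom_comm_group: "\<lbrakk>X \<in> Obj C; Y \<in> Obj C\<rbrakk> \<Longrightarrow> comm_group (hom_group C X Y)"
    and comp_plus: "\<lbrakk>f \<in> hom_set C X Y; g \<in> hom_set C X Y; h \<in> hom_set C Y Z\<rbrakk>
      \<Longrightarrow> h \<cdot> (f \<boxplus> g) = (h \<cdot> f) \<boxplus> (h \<cdot> g)"
    and plus_comp: "\<lbrakk>f \<in> hom_set C X Y; g \<in> hom_set C Y Z; h \<in> hom_set C Y Z\<rbrakk>
      \<Longrightarrow> (g \<boxplus> h) \<cdot> f = (g \<cdot> f) \<boxplus> (h \<cdot> f)"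

locale additive_category = preadditive_category C
  for C :: "('o, 'a, 'z) addcat_scheme" (structure) +
  assumes zero_object: "\<exists>Z\<in>Obj C. Ide C Z = Zero C Z Z"
    and biproducts: "\<lbrakk>X \<in> Obj C; Y \<in> Obj C\<rbrakk> \<Longrightarrow>
      \<exists>S\<in>Obj C. \<exists>i\<in>hom_set C X S. \<exists>j\<in>hom_set C Y S. \<exists>p\<in>hom_set C S X. \<exists>q\<in>hom_set C S Y.
        p \<cdot> i = Ide C X \<and> q \<cdot> j = Ide C Y \<and> p \<cdot> j = Zero C Y X \<and> q \<cdot> i = Zero C X Y \<and>
        (i \<cdot> p) \<boxplus> (j \<cdot> q) = Ide C S"

locale abelian_category = additive_category C
  for C :: "('o, 'a, 'z) addcat_scheme" (structure) +
  assumes kernels: "f \<in> Arr C \<Longrightarrow> \<exists>k. is_kernel C f k"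
    and cokernels: "f \<in> Arr C \<Longrightarrow> \<exists>c. is_cokernel C f c"
    and mono_normal: "mono C f \<Longrightarrow> \<exists>g. is_kernel C g f"
    and epi_normal: "epi C f \<Longrightarrow> \<exists>g. is_cokernel C g f"

text \<open>HOL has no distinction between sets and classes. Smallness is relative to a set \<open>U\<close> that
  plays the role of a universe: small index sets are, up to bijection, the subsets of \<open>U\<close> of
  cardinality less than that of \<open>U\<close>. For \<open>U\<close> of strongly inaccessible cardinality this is
  smallness with respect to a Grothendieck universe. Only an uncountable regular
  cardinality is required, since inaccessible ones cannot be proved to exist in HOL. Hom-sets are
  sets of the logic, without a cardinality bound.\<close>

definition regular_universe :: "'u set \<Rightarrow> bool" where
  "regular_universe U \<longleftrightarrow> natLeq <o |U| \<and> regularCard |U|"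

definition small :: "'u set \<Rightarrow> 'u set \<Rightarrow> bool" where
  "small U I \<longleftrightarrow> I \<subseteq> U \<and> |I| <o |U|"

locale grothendieck_category = abelian_category C
  for C :: "('o, 'a, 'z) addcat_scheme" (structure) and U :: "'u set" +
  assumes universe: "regular_universe U"
    and coproducts: "\<lbrakk>small U I; \<And>i. i \<in> I \<Longrightarrow> X i \<in> Obj C\<rbrakk> \<Longrightarrow> \<exists>S \<iota>. is_coproduct C I X S \<iota>"
    and direct_limits_exact:
      "\<lbrakk>small U I; directed_preorder I r;
        direct_system C I r X t; direct_system C I r X' t'; direct_system C I r X'' t'';
        direct_system_map C I r X t X' t' f; direct_system_map C I r X' t' X'' t'' g;
        \<And>i. i \<in> I \<Longrightarrow> short_exact C (f i) (g i);
        is_direct_limit C I r X t L c; is_direct_limit C I r X' t' L' c';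
        is_direct_limit C I r X'' t'' L'' c'';
        a \<in> hom_set C L L'; \<And>i. i \<in> I \<Longrightarrow> a \<cdot> c i = c' i \<cdot> f i;
        b \<in> hom_set C L' L''; \<And>i. i \<in> I \<Longrightarrow> b \<cdot> c' i = c'' i \<cdot> g i\<rbrakk>
      \<Longrightarrow> short_exact C a b"
    and generator: "\<exists>G. is_generator C G"


section \<open>Functors and natural transformations\<close>

text \<open>Functors and natural transformations are extensional functions (\<open>undefined\<close> outside the
  objects and arrows of their source), so that HOL equality is equality of functors, respectively
  of transformations.\<close>

record ('o, 'a, 'p, 'b) funct =
  FO :: "'o \<Rightarrow> 'p"
  FA :: "'a \<Rightarrow> 'b"

definition is_functor ::
  "('o, 'a, 'y) cat_scheme \<Rightarrow> ('p, 'b, 'z) cat_scheme \<Rightarrow> ('o, 'a, 'p, 'b) funct \<Rightarrow> bool" where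
  "is_functor C D F \<longleftrightarrow> FO F \<in> extensional (Obj C) \<and> FA F \<in> extensional (Arr C) \<and>
    (\<forall>X\<in>Obj C. FO F X \<in> Obj D \<and> FA F (Ide C X) = Ide D (FO F X)) \<and>
    (\<forall>X\<in>Obj C. \<forall>Y\<in>Obj C. \<forall>f\<in>hom_set C X Y. FA F f \<in> hom_set D (FO F X) (FO F Y)) \<and>
    (\<forall>X\<in>Obj C. \<forall>Y\<in>Obj C. \<forall>Z\<in>Obj C. \<forall>f\<in>hom_set C X Y. \<forall>g\<in>hom_set C Y Z.
      FA F (g \<cdot>\<^bsub>C\<^esub> f) = FA F g \<cdot>\<^bsub>D\<^esub> FA F f)"

definition id_funct :: "('o, 'a, 'z) cat_scheme \<Rightarrow> ('o, 'a, 'o, 'a) funct" where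
  "id_funct C = \<lparr>FO = (\<lambda>X\<in>Obj C. X), FA = (\<lambda>f\<in>Arr C. f)\<rparr>"

text \<open>\<open>comp_funct C G F\<close> is the composite \<open>GF\<close>, where \<open>C\<close> is the source of \<open>F\<close>.\<close>

definition comp_funct ::
  "('o, 'a, 'z) cat_scheme \<Rightarrow> ('p, 'b, 'q, 'c) funct \<Rightarrow> ('o, 'a, 'p, 'b) funct \<Rightarrow>
    ('o, 'a, 'q, 'c) funct" where
  "comp_funct C G F = \<lparr>FO = compose (Obj C) (FO G) (FO F), FA = compose (Arr C) (FA G) (FA F)\<rparr>"

definition additive_functor ::
  "('o, 'a, 'y) addcat_scheme \<Rightarrow> ('p, 'b, 'z) addcat_scheme \<Rightarrow> ('o, 'a, 'p, 'b) funct \<Rightarrow> bool" where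
  "additive_functor C D F \<longleftrightarrow> is_functor C D F \<and>
    (\<forall>X\<in>Obj C. \<forall>Y\<in>Obj C. \<forall>f\<in>hom_set C X Y. \<forall>g\<in>hom_set C X Y.
      FA F (f \<boxplus>\<^bsub>C\<^esub> g) = FA F f \<boxplus>\<^bsub>D\<^esub> FA F g)"

definition preserves_cokernels ::
  "('o, 'a, 'y) addcat_scheme \<Rightarrow> ('p, 'b, 'z) addcat_scheme \<Rightarrow> ('o, 'a, 'p, 'b) funct \<Rightarrow> bool" where
  "preserves_cokernels C D F \<longleftrightarrow>
    (\<forall>f c. is_cokernel C f c \<longrightarrow> is_cokernel D (FA F f) (FA F c))"

definition commutes_with_direct_sums ::
  "'u set \<Rightarrow> ('o, 'a, 'y) cat_scheme \<Rightarrow> ('p, 'b, 'z) cat_scheme \<Rightarrow> ('o, 'a, 'p, 'b) funct \<Rightarrow> bool"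
  where
  "commutes_with_direct_sums U C D F \<longleftrightarrow>
    (\<forall>I X S \<iota>. small U I \<and> (\<forall>i\<in>I. X i \<in> Obj C) \<and> is_coproduct C I X S \<iota> \<longrightarrow>
      is_coproduct D I (\<lambda>i. FO F (X i)) (FO F S) (\<lambda>i. FA F (\<iota> i)))"

definition nat_trans ::
  "('o, 'a, 'y) cat_scheme \<Rightarrow> ('p, 'b, 'z) cat_scheme \<Rightarrow>
    ('o, 'a, 'p, 'b) funct \<Rightarrow> ('o, 'a, 'p, 'b) funct \<Rightarrow> ('o \<Rightarrow> 'b) \<Rightarrow> bool" where
  "nat_trans C D F G \<tau> \<longleftrightarrow> \<tau> \<in> extensional (Obj C) \<and>
    (\<forall>X\<in>Obj C. \<tau> X \<in> hom_set D (FO F X) (FO G X)) \<and>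
    (\<forall>X\<in>Obj C. \<forall>Y\<in>Obj C. \<forall>f\<in>hom_set C X Y.
      FA G f \<cdot>\<^bsub>D\<^esub> \<tau> X = \<tau> Y \<cdot>\<^bsub>D\<^esub> FA F f)"

definition id_trans ::
  "('o, 'a, 'y) cat_scheme \<Rightarrow> ('p, 'b, 'z) cat_scheme \<Rightarrow> ('o, 'a, 'p, 'b) funct \<Rightarrow> 'o \<Rightarrow> 'b" where
  "id_trans C D F = (\<lambda>X\<in>Obj C. Ide D (FO F X))"

definition vcomp ::
  "('o, 'a, 'y) cat_scheme \<Rightarrow> ('p, 'b, 'z) cat_scheme \<Rightarrow> ('o \<Rightarrow> 'b) \<Rightarrow> ('o \<Rightarrow> 'b) \<Rightarrow> 'o \<Rightarrow> 'b" where
  "vcomp C D \<sigma> \<tau> = (\<lambda>X\<in>Obj C. \<sigma> X \<cdot>\<^bsub>D\<^esub> \<tau> X)"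

text \<open>For a transformation \<open>\<beta>\<close> and functors \<open>H\<close>, \<open>I\<close>, the transformations \<open>\<beta>\<^sub>I\<close> and \<open>H\<beta>\<close>; the first
  argument is the source of \<open>I\<close>, respectively of the functors between which \<open>\<beta>\<close> is defined.\<close>

definition whisker_right ::
  "('o, 'a, 'z) cat_scheme \<Rightarrow> ('p \<Rightarrow> 'b) \<Rightarrow> ('o, 'a, 'p, 'c) funct \<Rightarrow> 'o \<Rightarrow> 'b" where
  "whisker_right C \<beta> I = (\<lambda>X\<in>Obj C. \<beta> (FO I X))"

definition whisker_left ::
  "('o, 'a, 'z) cat_scheme \<Rightarrow> ('p, 'b, 'q, 'c) funct \<Rightarrow> ('o \<Rightarrow> 'b) \<Rightarrow> 'o \<Rightarrow> 'c" where
  "whisker_left C H \<beta> = (\<lambda>X\<in>Obj C. FA H (\<beta> X))"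

text \<open>Separability: \<open>P X Y\<close> are the components of the natural left inverse
  \<open>Hom(F(-), F(-)) \<rightarrow> Hom(-, -)\<close>, whose naturality is that of functors on \<open>C\<^sup>o\<^sup>p \<times> C\<close>.\<close>

definition separable_functor ::
  "('o, 'a, 'y) cat_scheme \<Rightarrow> ('p, 'b, 'z) cat_scheme \<Rightarrow> ('o, 'a, 'p, 'b) funct \<Rightarrow> bool" where
  "separable_functor C D F \<longleftrightarrow>
    (\<exists>P :: 'o \<Rightarrow> 'o \<Rightarrow> 'b \<Rightarrow> 'a.
      (\<forall>X\<in>Obj C. \<forall>Y\<in>Obj C. \<forall>g\<in>hom_set D (FO F X) (FO F Y). P X Y g \<in> hom_set C X Y) \<and>
      (\<forall>X\<in>Obj C. \<forall>Y\<in>Obj C. \<forall>X'\<in>Obj C. \<forall>Y'\<in>Obj C.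
        \<forall>a\<in>hom_set C X' X. \<forall>b\<in>hom_set C Y Y'. \<forall>g\<in>hom_set D (FO F X) (FO F Y).
          P X' Y' (FA F b \<cdot>\<^bsub>D\<^esub> g \<cdot>\<^bsub>D\<^esub> FA F a) = b \<cdot>\<^bsub>C\<^esub> P X Y g \<cdot>\<^bsub>C\<^esub> a) \<and>
      (\<forall>X\<in>Obj C. \<forall>Y\<in>Obj C. \<forall>f\<in>hom_set C X Y. P X Y (FA F f) = f))"

definition relative_injective ::
  "('o, 'a, 'y) cat_scheme \<Rightarrow> ('p, 'b, 'z) cat_scheme \<Rightarrow> ('o, 'a, 'p, 'b) funct \<Rightarrow> 'o \<Rightarrow> bool" where
  "relative_injective C D F M \<longleftrightarrow>
    (\<forall>X\<in>Obj C. \<forall>X'\<in>Obj C. \<forall>i\<in>hom_set C X X'. split_mono D (FA F i) \<longrightarrow>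
      (\<forall>f\<in>hom_set C X M. \<exists>g\<in>hom_set C X' M. g \<cdot>\<^bsub>C\<^esub> i = f))"

definition maschke_functor ::
  "('o, 'a, 'y) cat_scheme \<Rightarrow> ('p, 'b, 'z) cat_scheme \<Rightarrow> ('o, 'a, 'p, 'b) funct \<Rightarrow> bool" where
  "maschke_functor C D F \<longleftrightarrow> (\<forall>M\<in>Obj C. relative_injective C D F M)"


section \<open>Comonads and comodules\<close>

definition comonad ::
  "('o, 'a, 'z) addcat_scheme \<Rightarrow> ('o, 'a, 'o, 'a) funct \<Rightarrow> ('o \<Rightarrow> 'a) \<Rightarrow> ('o \<Rightarrow> 'a) \<Rightarrow> bool" where
  "comonad A F \<delta> \<xi> \<longleftrightarrow> additive_functor A A F \<and>
    nat_trans A A F (comp_funct A F F) \<delta> \<and> nat_trans A A F (id_funct A) \<xi> \<and>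
    vcomp A A (whisker_right A \<delta> F) \<delta> = vcomp A A (whisker_left A F \<delta>) \<delta> \<and>
    vcomp A A (whisker_left A F \<xi>) \<delta> = id_trans A A F \<and>
    vcomp A A (whisker_right A \<xi> F) \<delta> = id_trans A A F"

text \<open>The category with objects \<open>Ob\<close>, hom-sets \<open>H x y\<close>, identities \<open>e x\<close> and composition \<open>c\<close>.
  An arrow is a triple (source, underlying datum, target), which makes the hom-sets disjoint.\<close>

definition cat_of ::
  "'x set \<Rightarrow> ('x \<Rightarrow> 'x \<Rightarrow> 'h set) \<Rightarrow> ('x \<Rightarrow> 'h) \<Rightarrow> ('h \<Rightarrow> 'h \<Rightarrow> 'h) \<Rightarrow> ('x, 'x \<times> 'h \<times> 'x) cat" where
  "cat_of Ob H e c =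
    \<lparr>Obj = Ob, Arr = {(x, h, y). x \<in> Ob \<and> y \<in> Ob \<and> h \<in> H x y},
     Dom = (\<lambda>(x, h, y). x), Cod = (\<lambda>(x, h, y). y), Ide = (\<lambda>x. (x, e x, x)),
     Comp = (\<lambda>(y, k, z) (x, h, y'). (x, c k h, z))\<rparr>"

text \<open>\<open>\<A>\<^sup>F\<close>\<close>

definition comod_cat ::
  "('o, 'a, 'z) addcat_scheme \<Rightarrow> ('o, 'a, 'o, 'a) funct \<Rightarrow> ('o \<Rightarrow> 'a) \<Rightarrow> ('o \<Rightarrow> 'a) \<Rightarrow>
    ('o \<times> 'a, ('o \<times> 'a) \<times> 'a \<times> ('o \<times> 'a)) cat" where
  "comod_cat A F \<delta> \<xi> = cat_of
    {(X, d). X \<in> Obj A \<and> d \<in> hom_set A X (FO F X) \<and>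
       \<delta> X \<cdot>\<^bsub>A\<^esub> d = FA F d \<cdot>\<^bsub>A\<^esub> d \<and> \<xi> X \<cdot>\<^bsub>A\<^esub> d = Ide A X}
    (\<lambda>(X, d) (X', d'). {f \<in> hom_set A X X'. d' \<cdot>\<^bsub>A\<^esub> f = FA F f \<cdot>\<^bsub>A\<^esub> d})
    (\<lambda>(X, d). Ide A X)
    (Comp A)"

definition forget_comod ::
  "('o, 'a, 'z) addcat_scheme \<Rightarrow> ('o, 'a, 'o, 'a) funct \<Rightarrow> ('o \<Rightarrow> 'a) \<Rightarrow> ('o \<Rightarrow> 'a) \<Rightarrow>
    ('o \<times> 'a, ('o \<times> 'a) \<times> 'a \<times> ('o \<times> 'a), 'o, 'a) funct" where
  "forget_comod A F \<delta> \<xi> =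
    \<lparr>FO = (\<lambda>(X, d)\<in>Obj (comod_cat A F \<delta> \<xi>). X),
     FA = (\<lambda>(x, f, y)\<in>Arr (comod_cat A F \<delta> \<xi>). f)\<rparr>"

text \<open>The objects of the category of additive functors preserving cokernels and commuting with
  direct sums.\<close>

definition Funt :: "'u set \<Rightarrow> ('o, 'a, 'z) addcat_scheme \<Rightarrow> ('o, 'a, 'o, 'a) funct set" where
  "Funt U A = {M. additive_functor A A M \<and> preserves_cokernels A A M \<and>
     commutes_with_direct_sums U A A M}"

definition is_left_comod ::
  "'u set \<Rightarrow> ('o, 'a, 'z) addcat_scheme \<Rightarrow> ('o, 'a, 'o, 'a) funct \<Rightarrow> ('o \<Rightarrow> 'a) \<Rightarrow> ('o \<Rightarrow> 'a) \<Rightarrow>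
    ('o, 'a, 'o, 'a) funct \<Rightarrow> ('o \<Rightarrow> 'a) \<Rightarrow> bool" where
  "is_left_comod U A F \<delta> \<xi> M m \<longleftrightarrow> M \<in> Funt U A \<and> nat_trans A A M (comp_funct A F M) m \<and>
    vcomp A A (whisker_right A \<delta> M) m = vcomp A A (whisker_left A F m) m \<and>
    vcomp A A (whisker_right A \<xi> M) m = id_trans A A M"

definition is_bicomod ::
  "'u set \<Rightarrow> ('o, 'a, 'z) addcat_scheme \<Rightarrow> ('o, 'a, 'o, 'a) funct \<Rightarrow> ('o \<Rightarrow> 'a) \<Rightarrow> ('o \<Rightarrow> 'a) \<Rightarrow>
    ('o, 'a, 'o, 'a) funct \<Rightarrow> ('o \<Rightarrow> 'a) \<Rightarrow> ('o \<Rightarrow> 'a) \<Rightarrow> bool" where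
  "is_bicomod U A F \<delta> \<xi> M m n \<longleftrightarrow> is_left_comod U A F \<delta> \<xi> M m \<and>
    nat_trans A A M (comp_funct A M F) n \<and>
    vcomp A A (whisker_left A M \<delta>) n = vcomp A A (whisker_right A n F) n \<and>
    vcomp A A (whisker_left A M \<xi>) n = id_trans A A M \<and>
    vcomp A A (whisker_right A m F) n = vcomp A A (whisker_left A F n) m"

text \<open>\<open>\<^sub>\<A>\<M>\<^sup>F\<close>\<close>

definition left_comod_cat ::
  "'u set \<Rightarrow> ('o, 'a, 'z) addcat_scheme \<Rightarrow> ('o, 'a, 'o, 'a) funct \<Rightarrow> ('o \<Rightarrow> 'a) \<Rightarrow> ('o \<Rightarrow> 'a) \<Rightarrow>
    (('o, 'a, 'o, 'a) funct \<times> ('o \<Rightarrow> 'a),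
     (('o, 'a, 'o, 'a) funct \<times> ('o \<Rightarrow> 'a)) \<times> ('o \<Rightarrow> 'a) \<times>
     (('o, 'a, 'o, 'a) funct \<times> ('o \<Rightarrow> 'a))) cat" where
  "left_comod_cat U A F \<delta> \<xi> = cat_of
    {(M, m). is_left_comod U A F \<delta> \<xi> M m}
    (\<lambda>(M, m) (M', m'). {f. nat_trans A A M M' f \<and>
       vcomp A A m' f = vcomp A A (whisker_left A F f) m})
    (\<lambda>(M, m). id_trans A A M)
    (vcomp A A)"

text \<open>\<open>\<^sup>F\<M>\<^sup>F\<close>\<close>

definition bicomod_cat ::
  "'u set \<Rightarrow> ('o, 'a, 'z) addcat_scheme \<Rightarrow> ('o, 'a, 'o, 'a) funct \<Rightarrow> ('o \<Rightarrow> 'a) \<Rightarrow> ('o \<Rightarrow> 'a) \<Rightarrow>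
    (('o, 'a, 'o, 'a) funct \<times> ('o \<Rightarrow> 'a) \<times> ('o \<Rightarrow> 'a),
     (('o, 'a, 'o, 'a) funct \<times> ('o \<Rightarrow> 'a) \<times> ('o \<Rightarrow> 'a)) \<times> ('o \<Rightarrow> 'a) \<times>
     (('o, 'a, 'o, 'a) funct \<times> ('o \<Rightarrow> 'a) \<times> ('o \<Rightarrow> 'a))) cat" where
  "bicomod_cat U A F \<delta> \<xi> = cat_of
    {(M, m, n). is_bicomod U A F \<delta> \<xi> M m n}
    (\<lambda>(M, m, n) (M', m', n'). {f. nat_trans A A M M' f \<and>
       vcomp A A m' f = vcomp A A (whisker_left A F f) m \<and>
       vcomp A A n' f = vcomp A A (whisker_right A f F) n})
    (\<lambda>(M, m, n). id_trans A A M)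
    (vcomp A A)"

definition forget_bicomod ::
  "'u set \<Rightarrow> ('o, 'a, 'z) addcat_scheme \<Rightarrow> ('o, 'a, 'o, 'a) funct \<Rightarrow> ('o \<Rightarrow> 'a) \<Rightarrow> ('o \<Rightarrow> 'a) \<Rightarrow>
    (('o, 'a, 'o, 'a) funct \<times> ('o \<Rightarrow> 'a) \<times> ('o \<Rightarrow> 'a),
     (('o, 'a, 'o, 'a) funct \<times> ('o \<Rightarrow> 'a) \<times> ('o \<Rightarrow> 'a)) \<times> ('o \<Rightarrow> 'a) \<times>
     (('o, 'a, 'o, 'a) funct \<times> ('o \<Rightarrow> 'a) \<times> ('o \<Rightarrow> 'a)),
     ('o, 'a, 'o, 'a) funct \<times> ('o \<Rightarrow> 'a),
     (('o, 'a, 'o, 'a) funct \<times> ('o \<Rightarrow> 'a)) \<times> ('o \<Rightarrow> 'a) \<times>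
     (('o, 'a, 'o, 'a) funct \<times> ('o \<Rightarrow> 'a))) funct" where
  "forget_bicomod U A F \<delta> \<xi> =
    \<lparr>FO = (\<lambda>(M, m, n)\<in>Obj (bicomod_cat U A F \<delta> \<xi>). (M, m)),
     FA = (\<lambda>((M, m, n), f, (M', m', n'))\<in>Arr (bicomod_cat U A F \<delta> \<xi>). ((M, m), f, (M', m')))\<rparr>"

end

theory Submission
  imports Defs
begin

text \<open>
  A bicolinear retraction \<open>\<gamma>\<close> of \<open>\<delta>\<close> and a natural transformation \<open>\<theta> : F\<^sup>2 \<rightarrow> id\<close> with
  \<open>\<theta> \<circ> \<delta> = \<xi>\<close> and \<open>F\<theta> \<circ> \<delta>\<^sub>F = \<theta>\<^sub>F \<circ> F\<delta>\<close> (a cointegral) are related by \<open>\<theta> = \<xi> \<circ> \<gamma>\<close>.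
  Given a cointegral, an arrow \<open>g : X \<rightarrow> Y\<close> between comodules \<open>(X, d)\<close>, \<open>(Y, e)\<close> is averaged to the
  colinear arrow \<open>\<theta>\<^sub>Y \<circ> F(e \<circ> g) \<circ> d\<close>, which gives separability. Likewise a left colinear
  \<open>h : M \<rightarrow> N\<close> between bicomodules with right coactions \<open>n\<close>, \<open>q\<close> is averaged to the bicolinear
  \<open>N\<theta> \<circ> q\<^sub>F \<circ> h\<^sub>F \<circ> n\<close>; applied to a left colinear retraction followed by \<open>f\<close>, this extends \<open>f\<close>.
  Conversely, separability splits the unit of the cofree adjunction naturally, and \<open>F\<xi>\<close> is a left
  colinear retraction of \<open>\<delta>\<close>, so that relative injectivity of \<open>(F, \<delta>, \<delta>)\<close> yields \<open>\<gamma>\<close>.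
\<close>

section \<open>Arrows, functors and transformations\<close>

context category
begin

lemma hom_iff: "f \<in> hom_set C X Y \<longleftrightarrow> f \<in> Arr C \<and> Dom C f = X \<and> Cod C f = Y"
  by (auto simp: hom_set_def)

lemma ide_arr [simp]:
  assumes "X \<in> Obj C"
  shows "Ide C X \<in> Arr C" "Dom C (Ide C X) = X" "Cod C (Ide C X) = X"
  using ide_hom[OF assms] by (auto simp: hom_iff)

lemma comp_arr [simp]:
  assumes "f \<in> Arr C" "g \<in> Arr C" "Dom C g = Cod C f"
  shows "g \<cdot> f \<in> Arr C" "Dom C (g \<cdot> f) = Dom C f" "Cod C (g \<cdot> f) = Cod C g"
  using comp_hom[of f "Dom C f" "Cod C f" g "Cod C g"] assms by (auto simp: hom_iff)

text \<open>Fixes right-nested composites as the normal form of the simplifier. The side conditions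
  are equations between \<open>Dom\<close> and \<open>Cod\<close>, so no intermediate object has to
  be guessed as with \<open>hom_set\<close>.\<close>

lemma comp_arr_assoc [simp]:
  assumes "f \<in> Arr C" "g \<in> Arr C" "h \<in> Arr C" "Dom C g = Cod C f" "Dom C h = Cod C g"
  shows "(h \<cdot> g) \<cdot> f = h \<cdot> (g \<cdot> f)"
  using assms comp_assoc[of f "Dom C f" "Cod C f" g "Cod C g" h "Cod C h"] by (auto simp: hom_iff)

lemma comp_arr_ide [simp]: "f \<in> Arr C \<Longrightarrow> X = Dom C f \<Longrightarrow> f \<cdot> Ide C X = f"
  using comp_ide by (auto simp: hom_iff)

lemma ide_comp_arr [simp]: "f \<in> Arr C \<Longrightarrow> X = Cod C f \<Longrightarrow> Ide C X \<cdot> f = f"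
  using ide_comp by (auto simp: hom_iff)

declare dom_obj [simp] cod_obj [simp]

lemma functorI:
  assumes "FO F \<in> extensional (Obj C)" "FA F \<in> extensional (Arr C)"
    and "\<And>X. X \<in> Obj C \<Longrightarrow> FO F X \<in> Obj D"
    and "\<And>X. X \<in> Obj C \<Longrightarrow> FA F (Ide C X) = Ide D (FO F X)"
    and "\<And>f. f \<in> Arr C \<Longrightarrow> FA F f \<in> hom_set D (FO F (Dom C f)) (FO F (Cod C f))"
    and "\<And>f g. \<lbrakk>f \<in> Arr C; g \<in> Arr C; Dom C g = Cod C f\<rbrakk> \<Longrightarrow>
      FA F (g \<cdot> f) = FA F g \<cdot>\<^bsub>D\<^esub> FA F f"
  shows "is_functor C D F"
  unfolding is_functor_def
proof (intro conjI ballI)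
  fix X Y f assume "f \<in> hom_set C X Y"
  then show "FA F f \<in> hom_set D (FO F X) (FO F Y)"
    using assms(5)[of f] by (simp add: hom_iff)
qed (use assms in \<open>auto simp: hom_iff\<close>)

lemma endofunctor_simps [simp]:
  assumes "is_functor C C F"
  shows "X \<in> Obj C \<Longrightarrow> FO F X \<in> Obj C"
    and "X \<in> Obj C \<Longrightarrow> FA F (Ide C X) = Ide C (FO F X)"
    and "f \<in> Arr C \<Longrightarrow> FA F f \<in> Arr C"
    and "f \<in> Arr C \<Longrightarrow> Dom C (FA F f) = FO F (Dom C f)"
    and "f \<in> Arr C \<Longrightarrow> Cod C (FA F f) = FO F (Cod C f)"
    and "\<lbrakk>f \<in> Arr C; g \<in> Arr C; Dom C g = Cod C f\<rbrakk> \<Longrightarrow> FA F (g \<cdot> f) = FA F g \<cdot> FA F f"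
proof -
  have hom: "FA F f \<in> hom_set C (FO F (Dom C f)) (FO F (Cod C f))" if "f \<in> Arr C" for f
  proof -
    have "f \<in> hom_set C (Dom C f) (Cod C f)" using that by (simp add: hom_iff)
    with that assms show ?thesis unfolding is_functor_def by (meson cod_obj dom_obj)
  qed
  show "f \<in> Arr C \<Longrightarrow> FA F f \<in> Arr C" "f \<in> Arr C \<Longrightarrow> Dom C (FA F f) = FO F (Dom C f)"
    "f \<in> Arr C \<Longrightarrow> Cod C (FA F f) = FO F (Cod C f)"
    using hom by (simp_all add: hom_iff)
  show "FA F (g \<cdot> f) = FA F g \<cdot> FA F f" if "f \<in> Arr C" "g \<in> Arr C" "Dom C g = Cod C f"
  proof -
    have "f \<in> hom_set C (Dom C f) (Cod C f)" "g \<in> hom_set C (Cod C f) (Cod C g)"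
      using that by (simp_all add: hom_iff)
    with that assms show ?thesis unfolding is_functor_def by (meson cod_obj dom_obj)
  qed
qed (use assms in \<open>simp_all add: is_functor_def\<close>)

text \<open>The objects \<open>X\<close> and \<open>Y\<close> in the naturality condition are
  determined by the arrow, so quantifying over arrows alone suffices.\<close>

lemma nat_trans_iff:
  "nat_trans C D F G \<tau> \<longleftrightarrow> \<tau> \<in> extensional (Obj C) \<and>
    (\<forall>X\<in>Obj C. \<tau> X \<in> hom_set D (FO F X) (FO G X)) \<and>
    (\<forall>f\<in>Arr C. FA G f \<cdot>\<^bsub>D\<^esub> \<tau> (Dom C f) = \<tau> (Cod C f) \<cdot>\<^bsub>D\<^esub> FA F f)"
  unfolding nat_trans_def by (auto simp: hom_iff)

lemma
  assumes "nat_trans C C F G \<tau>"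
  shows nat_trans_arr: "X \<in> Obj C \<Longrightarrow> \<tau> X \<in> Arr C"
    and nat_trans_dom: "X \<in> Obj C \<Longrightarrow> Dom C (\<tau> X) = FO F X"
    and nat_trans_cod: "X \<in> Obj C \<Longrightarrow> Cod C (\<tau> X) = FO G X"
    and naturality: "\<lbrakk>f \<in> Arr C; Dom C f = X; Cod C f = Y\<rbrakk> \<Longrightarrow>
      FA G f \<cdot> \<tau> X = \<tau> Y \<cdot> FA F f"
  using assms by (auto simp: nat_trans_iff hom_iff)

lemmas nat_trans_facts = nat_trans_arr nat_trans_dom nat_trans_cod

end

section \<open>Components of composite functors, whiskerings and vertical composites\<close>

lemma comp_funct_simps [simp]:
  "X \<in> Obj C \<Longrightarrow> FO (comp_funct C G F) X = FO G (FO F X)"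
  "f \<in> Arr C \<Longrightarrow> FA (comp_funct C G F) f = FA G (FA F f)"
  by (simp_all add: comp_funct_def compose_def)

lemma id_funct_simps [simp]:
  "X \<in> Obj C \<Longrightarrow> FO (id_funct C) X = X"
  "f \<in> Arr C \<Longrightarrow> FA (id_funct C) f = f"
  by (simp_all add: id_funct_def)

lemma whisker_simps [simp]:
  "X \<in> Obj C \<Longrightarrow> whisker_right C \<beta> I X = \<beta> (FO I X)"
  "X \<in> Obj C \<Longrightarrow> whisker_left C H \<beta> X = FA H (\<beta> X)"
  by (simp_all add: whisker_right_def whisker_left_def)

lemma trans_simps [simp]:
  "X \<in> Obj C \<Longrightarrow> id_trans C D F X = Ide D (FO F X)"
  "X \<in> Obj C \<Longrightarrow> vcomp C D \<sigma> \<tau> X = \<sigma> X \<cdot>\<^bsub>D\<^esub> \<tau> X"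
  by (simp_all add: id_trans_def vcomp_def)

lemma trans_extensional [simp]:
  "whisker_right C \<beta> I \<in> extensional (Obj C)" "whisker_left C H \<beta> \<in> extensional (Obj C)"
  "id_trans C D F \<in> extensional (Obj C)" "vcomp C D \<sigma> \<tau> \<in> extensional (Obj C)"
  by (simp_all add: whisker_right_def whisker_left_def id_trans_def vcomp_def)

text \<open>Both sides are extensional, so an equation of transformations is the family of its
  components. The comonad and comodule laws are used in this form throughout.\<close>

lemma vcomp_eq_iff:
  "vcomp C D \<sigma> \<tau> = \<rho> \<longleftrightarrow>
    \<rho> \<in> extensional (Obj C) \<and> (\<forall>X\<in>Obj C. \<sigma> X \<cdot>\<^bsub>D\<^esub> \<tau> X = \<rho> X)"
  by (metis extensionalityI trans_extensional(4) trans_simps(2))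

text \<open>Composite functors can be evaluated only on objects and arrows of their source. This
  congruence allows the evaluation under the binders of a coproduct, for indices in
  \<open>I\<close>.\<close>

lemma is_coproduct_cong:
  assumes "\<And>i. i \<in> I \<Longrightarrow> X i = X' i" "S = S'" "\<And>i. i \<in> I \<Longrightarrow> \<iota> i = \<iota>' i"
  shows "is_coproduct C I X S \<iota> \<longleftrightarrow> is_coproduct C I X' S' \<iota>'"
  unfolding is_coproduct_def using assms by (simp cong: ball_cong)

section \<open>Composition of endofunctors\<close>

context category
begin

lemma is_functor_comp_funct:
  assumes "is_functor C C M" "is_functor C C N"
  shows "is_functor C C (comp_funct C M N)"
  by (rule functorI) (use assms in \<open>auto simp: comp_funct_def compose_def hom_iff\<close>)

end

context preadditive_category
begin

text \<open>Makes \<open>comp_funct A F F\<close> available as the underlying functor of a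
  bicomodule. Each of the three properties is applied first for \<open>N\<close> and then for
  \<open>M\<close>.\<close>

lemma comp_funct_Funt:
  assumes M: "M \<in> Funt U C" and N: "N \<in> Funt U C"
  shows "comp_funct C M N \<in> Funt U C"
proof -
  have fun_M [simp]: "is_functor C C M" and fun_N [simp]: "is_functor C C N"
    using assms by (auto simp: Funt_def additive_functor_def)
  \<comment> \<open>Closure of the hom-group shows that the sum is an arrow, which is what
    evaluating the composite functor at it requires.\<close>
  have plus_arr: "f \<boxplus> g \<in> hom_set C X Y" if "f \<in> hom_set C X Y" "g \<in> hom_set C X Y" for f g X Y
  proof -
    interpret comm_group "hom_group C X Y"
      using that by (intro hom_comm_group) (auto simp: hom_iff)
    show ?thesis using m_closed[of f g] that by (simp add: hom_group_def)
  qed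
  have "additive_functor C C (comp_funct C M N)"
    unfolding additive_functor_def
  proof (intro conjI ballI)
    show "is_functor C C (comp_funct C M N)" by (rule is_functor_comp_funct) simp_all
    fix X Y f g
    assume XY: "X \<in> Obj C" "Y \<in> Obj C" and fg: "f \<in> hom_set C X Y" "g \<in> hom_set C X Y"
    have "f \<boxplus> g \<in> Arr C" using plus_arr[OF fg] by (simp add: hom_iff)
    moreover have "FA N f \<in> hom_set C (FO N X) (FO N Y)" "FA N g \<in> hom_set C (FO N X) (FO N Y)"
      using fg by (simp_all add: hom_iff)
    moreover have "FA N (f \<boxplus> g) = FA N f \<boxplus> FA N g"
      using N XY fg by (auto simp: Funt_def additive_functor_def)
    moreover have "FA M (f' \<boxplus> g') = FA M f' \<boxplus> FA M g'"
      if "f' \<in> hom_set C (FO N X) (FO N Y)" "g' \<in> hom_set C (FO N X) (FO N Y)" for f' g'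
      using M that endofunctor_simps(1)[OF fun_N XY(1)] endofunctor_simps(1)[OF fun_N XY(2)]
      by (simp add: Funt_def additive_functor_def)
    ultimately show "FA (comp_funct C M N) (f \<boxplus> g) =
        FA (comp_funct C M N) f \<boxplus> FA (comp_funct C M N) g"
      using fg by (simp add: hom_iff)
  qed
  moreover have "preserves_cokernels C C (comp_funct C M N)"
    unfolding preserves_cokernels_def
  proof (intro allI impI)
    fix f c assume fc: "is_cokernel C f c"
    then have "is_cokernel C (FA M (FA N f)) (FA M (FA N c))"
      using M N by (simp add: Funt_def preserves_cokernels_def)
    with fc show "is_cokernel C (FA (comp_funct C M N) f) (FA (comp_funct C M N) c)"
      by (simp add: is_cokernel_def)
  qed
  moreover have "commutes_with_direct_sums U C C (comp_funct C M N)"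
    unfolding commutes_with_direct_sums_def
  proof (intro allI impI, elim conjE)
    fix I X S \<iota>
    assume I: "small U I" and X: "\<forall>i\<in>I. X i \<in> Obj C" and S: "is_coproduct C I X S \<iota>"
    have "is_coproduct C I (\<lambda>i. FO N (X i)) (FO N S) (\<lambda>i. FA N (\<iota> i))"
      using N I X S by (simp add: Funt_def commutes_with_direct_sums_def)
    then have "is_coproduct C I (\<lambda>i. FO M (FO N (X i))) (FO M (FO N S)) (\<lambda>i. FA M (FA N (\<iota> i)))"
      using M I X by (simp add: Funt_def commutes_with_direct_sums_def)
    moreover have "S \<in> Obj C" "\<forall>i\<in>I. \<iota> i \<in> Arr C"
      using S by (auto simp: is_coproduct_def hom_iff)
    ultimately show "is_coproduct C I (\<lambda>i. FO (comp_funct C M N) (X i)) (FO (comp_funct C M N) S)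
        (\<lambda>i. FA (comp_funct C M N) (\<iota> i))"
      using X by (simp cong: is_coproduct_cong)
  qed
  ultimately show ?thesis by (simp add: Funt_def)
qed

end

section \<open>Categories of triples\<close>

lemma cat_of_simps [simp]:
  "Obj (cat_of Ob H e c) = Ob"
  "(x, h, y) \<in> Arr (cat_of Ob H e c) \<longleftrightarrow> x \<in> Ob \<and> y \<in> Ob \<and> h \<in> H x y"
  "Dom (cat_of Ob H e c) (x, h, y) = x"
  "Cod (cat_of Ob H e c) (x, h, y) = y"
  "Ide (cat_of Ob H e c) x = (x, e x, x)"
  "Comp (cat_of Ob H e c) (y, k, z) (x, h, y') = (x, c k h, z)"
  by (auto simp: cat_of_def)

lemma hom_cat_of:
  "hom_set (cat_of Ob H e c) x y = {(x, h, y) | h. x \<in> Ob \<and> y \<in> Ob \<and> h \<in> H x y}"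
  by (auto simp: cat_of_def hom_set_def)

lemma split_mono_cat_of:
  "split_mono (cat_of Ob H e c) (x, h, y) \<longleftrightarrow>
    x \<in> Ob \<and> y \<in> Ob \<and> h \<in> H x y \<and> (\<exists>g\<in>H y x. c g h = e x)"
  by (auto simp: split_mono_def hom_cat_of)

section \<open>Cointegrals\<close>

locale comonad_category = category A
  for A :: "('o, 'a, 'z) addcat_scheme" (structure) +
  fixes F :: "('o, 'a, 'o, 'a) funct" and \<delta> \<xi> :: "'o \<Rightarrow> 'a"
  assumes comonad: "comonad A F \<delta> \<xi>"
begin

lemma functor_F [simp]: "is_functor A A F"
  and nat_\<delta>: "nat_trans A A F (comp_funct A F F) \<delta>"
  and nat_\<xi>: "nat_trans A A F (id_funct A) \<xi>"
  using comonad by (auto simp: comonad_def additive_functor_def)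

lemma comonad_arr [simp]:
  assumes "X \<in> Obj A"
  shows "\<delta> X \<in> Arr A" "Dom A (\<delta> X) = FO F X" "Cod A (\<delta> X) = FO F (FO F X)"
    and "\<xi> X \<in> Arr A" "Dom A (\<xi> X) = FO F X" "Cod A (\<xi> X) = X"
  using assms nat_trans_facts[OF nat_\<delta> assms] nat_trans_facts[OF nat_\<xi> assms] by auto

lemma naturality_\<delta>:
  "f \<in> Arr A \<Longrightarrow> FA F (FA F f) \<cdot> \<delta> (Dom A f) = \<delta> (Cod A f) \<cdot> FA F f"
  using naturality[OF nat_\<delta>, of f] by simp

lemma naturality_\<xi>: "f \<in> Arr A \<Longrightarrow> \<xi> (Cod A f) \<cdot> FA F f = f \<cdot> \<xi> (Dom A f)"
  using naturality[OF nat_\<xi>, of f] by simp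

lemma
  assumes "X \<in> Obj A"
  shows coassoc: "\<delta> (FO F X) \<cdot> \<delta> X = FA F (\<delta> X) \<cdot> \<delta> X"
    and counit_left: "FA F (\<xi> X) \<cdot> \<delta> X = Ide A (FO F X)"
    and counit_right: "\<xi> (FO F X) \<cdot> \<delta> X = Ide A (FO F X)"
  using comonad assms by (auto simp: comonad_def vcomp_eq_iff)

text \<open>Values outside \<open>Obj A\<close> are unconstrained, in contrast to
  \<open>nat_trans\<close>, so that unrestricted lambda terms qualify as cointegrals.\<close>

definition cointegral :: "('o \<Rightarrow> 'a) \<Rightarrow> bool" where
  "cointegral \<theta> \<longleftrightarrow>
    (\<forall>X\<in>Obj A. \<theta> X \<in> hom_set A (FO F (FO F X)) X \<and> \<theta> X \<cdot> \<delta> X = \<xi> X \<and>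
      FA F (\<theta> X) \<cdot> \<delta> (FO F X) = \<theta> (FO F X) \<cdot> FA F (\<delta> X)) \<and>
    (\<forall>f\<in>Arr A. f \<cdot> \<theta> (Dom A f) = \<theta> (Cod A f) \<cdot> FA F (FA F f))"

lemma
  assumes "cointegral \<theta>"
  shows cointegral_arr: "X \<in> Obj A \<Longrightarrow> \<theta> X \<in> Arr A"
    and cointegral_dom: "X \<in> Obj A \<Longrightarrow> Dom A (\<theta> X) = FO F (FO F X)"
    and cointegral_cod: "X \<in> Obj A \<Longrightarrow> Cod A (\<theta> X) = X"
    and cointegral_\<delta>: "X \<in> Obj A \<Longrightarrow> \<theta> X \<cdot> \<delta> X = \<xi> X"
    and cointegral_balanced: "X \<in> Obj A \<Longrightarrow>
      FA F (\<theta> X) \<cdot> \<delta> (FO F X) = \<theta> (FO F X) \<cdot> FA F (\<delta> X)"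
    and cointegral_nat: "f \<in> Arr A \<Longrightarrow> f \<cdot> \<theta> (Dom A f) = \<theta> (Cod A f) \<cdot> FA F (FA F f)"
  using assms by (auto simp: cointegral_def hom_iff)

lemmas cointegral_facts = cointegral_arr cointegral_dom cointegral_cod

text \<open>In components, a left inverse of \<open>\<delta>\<close> in the bicomodule category,
  where \<open>F\<^sup>2\<close> has left coaction \<open>\<delta>\<^sub>F\<close> and right
  coaction \<open>F\<delta>\<close>.\<close>

definition bicolinear_retraction :: "('o \<Rightarrow> 'a) \<Rightarrow> bool" where
  "bicolinear_retraction \<gamma> \<longleftrightarrow> nat_trans A A (comp_funct A F F) F \<gamma> \<and>
    (\<forall>X\<in>Obj A. \<gamma> X \<cdot> \<delta> X = Ide A (FO F X) \<and>
      \<delta> X \<cdot> \<gamma> X = FA F (\<gamma> X) \<cdot> \<delta> (FO F X) \<and>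
      \<delta> X \<cdot> \<gamma> X = \<gamma> (FO F X) \<cdot> FA F (\<delta> X))"

text \<open>Both sides of the balance condition equal \<open>\<gamma> X\<close>: left colinearity
  turns one into \<open>F\<xi> \<circ> \<delta> \<circ> \<gamma>\<close>, right colinearity turns
  the other into \<open>\<xi>\<^sub>F \<circ> \<delta> \<circ> \<gamma>\<close>, and the two counit
  laws apply.\<close>

lemma cointegral_of_retraction:
  assumes "bicolinear_retraction \<gamma>"
  shows "cointegral (\<lambda>X. \<xi> X \<cdot> \<gamma> X)"
proof -
  have nat: "nat_trans A A (comp_funct A F F) F \<gamma>"
    using assms by (simp add: bicolinear_retraction_def)
  have arr [simp]: "\<gamma> X \<in> Arr A" "Dom A (\<gamma> X) = FO F (FO F X)" "Cod A (\<gamma> X) = FO F X"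
    if "X \<in> Obj A" for X
    using that nat_trans_facts[OF nat that] by simp_all
  have retr: "\<gamma> X \<cdot> \<delta> X = Ide A (FO F X)"
    and left: "FA F (\<gamma> X) \<cdot> \<delta> (FO F X) = \<delta> X \<cdot> \<gamma> X"
    and right: "\<gamma> (FO F X) \<cdot> FA F (\<delta> X) = \<delta> X \<cdot> \<gamma> X" if "X \<in> Obj A" for X
    using assms that by (auto simp: bicolinear_retraction_def)
  have "FA F (\<xi> X) \<cdot> \<delta> X \<cdot> \<gamma> X = \<gamma> X" "\<xi> (FO F X) \<cdot> \<delta> X \<cdot> \<gamma> X = \<gamma> X" if "X \<in> Obj A" for X
    using that arg_cong[OF counit_left[OF that], of "\<lambda>t. t \<cdot> \<gamma> X"]
      arg_cong[OF counit_right[OF that], of "\<lambda>t. t \<cdot> \<gamma> X"] by simp_all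
  then have balanced: "FA F (\<xi> X \<cdot> \<gamma> X) \<cdot> \<delta> (FO F X) = (\<xi> (FO F X) \<cdot> \<gamma> (FO F X)) \<cdot> FA F (\<delta> X)"
    if "X \<in> Obj A" for X
    using that by (simp add: left right)
  have natural: "f \<cdot> \<xi> (Dom A f) \<cdot> \<gamma> (Dom A f) = (\<xi> (Cod A f) \<cdot> \<gamma> (Cod A f)) \<cdot> FA F (FA F f)"
    if f: "f \<in> Arr A" for f
  proof -
    have "f \<cdot> \<xi> (Dom A f) \<cdot> \<gamma> (Dom A f) = (f \<cdot> \<xi> (Dom A f)) \<cdot> \<gamma> (Dom A f)" using f by simp
    also have "\<dots> = \<xi> (Cod A f) \<cdot> FA F f \<cdot> \<gamma> (Dom A f)"
      using f by (simp flip: naturality_\<xi>)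
    also have "\<dots> = \<xi> (Cod A f) \<cdot> \<gamma> (Cod A f) \<cdot> FA F (FA F f)"
      using f naturality[OF nat, of f] by simp
    finally show ?thesis using f by simp
  qed
  show ?thesis
    unfolding cointegral_def using balanced natural by (simp add: hom_iff retr)
qed

section \<open>Comodules\<close>

lemma comod_obj:
  "(X, d) \<in> Obj (comod_cat A F \<delta> \<xi>) \<longleftrightarrow> X \<in> Obj A \<and> d \<in> Arr A \<and> Dom A d = X \<and>
    Cod A d = FO F X \<and> \<delta> X \<cdot> d = FA F d \<cdot> d \<and> \<xi> X \<cdot> d = Ide A X"
  by (auto simp: comod_cat_def hom_iff)

lemma comod_arr:
  "(x, f, y) \<in> Arr (comod_cat A F \<delta> \<xi>) \<longleftrightarrow> x \<in> Obj (comod_cat A F \<delta> \<xi>) \<and>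
    y \<in> Obj (comod_cat A F \<delta> \<xi>) \<and> f \<in> Arr A \<and> Dom A f = fst x \<and> Cod A f = fst y \<and>
    snd y \<cdot> f = FA F f \<cdot> snd x"
  by (cases x; cases y) (simp add: comod_cat_def hom_iff)

lemma comod_hom:
  "hom_set (comod_cat A F \<delta> \<xi>) x y = {(x, f, y) | f. (x, f, y) \<in> Arr (comod_cat A F \<delta> \<xi>)}"
  unfolding comod_cat_def hom_cat_of by auto

lemma comod_simps [simp]:
  "Comp (comod_cat A F \<delta> \<xi>) (y, g, z) (x, f, y') = (x, g \<cdot> f, z)"
  "Ide (comod_cat A F \<delta> \<xi>) x = (x, Ide A (fst x), x)"
  by (simp_all add: comod_cat_def split_beta)

lemma forget_comod_simps [simp]:
  "x \<in> Obj (comod_cat A F \<delta> \<xi>) \<Longrightarrow> FO (forget_comod A F \<delta> \<xi>) x = fst x"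
  "(x, f, y) \<in> Arr (comod_cat A F \<delta> \<xi>) \<Longrightarrow> FA (forget_comod A F \<delta> \<xi>) (x, f, y) = f"
  by (simp_all add: forget_comod_def split_beta)

lemma cofree_comod: "X \<in> Obj A \<Longrightarrow> (FO F X, \<delta> X) \<in> Obj (comod_cat A F \<delta> \<xi>)"
  by (simp add: comod_obj coassoc counit_right)

text \<open>Naturality of \<open>\<theta>\<close> moves \<open>e\<close> to its right,
  coassociativity of \<open>e\<close> replaces \<open>F(F e)\<close> by \<open>F\<delta>\<close>,
  and the balance condition turns \<open>\<theta>\<^sub>F \<circ> F\<delta>\<close> into
  \<open>F\<theta> \<circ> \<delta>\<^sub>F\<close>. Then \<open>\<delta>\<close> travels right by
  naturality until coassociativity of \<open>d\<close> absorbs it.\<close>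

lemma comod_average_colinear:
  assumes \<theta>: "cointegral \<theta>" and x: "(X, d) \<in> Obj (comod_cat A F \<delta> \<xi>)"
    and y: "(Y, e) \<in> Obj (comod_cat A F \<delta> \<xi>)" and g: "g \<in> hom_set A X Y"
  shows "((X, d), \<theta> Y \<cdot> FA F e \<cdot> FA F g \<cdot> d, (Y, e)) \<in> Arr (comod_cat A F \<delta> \<xi>)"
proof -
  have [simp]: "X \<in> Obj A" "d \<in> Arr A" "Dom A d = X" "Cod A d = FO F X"
    "Y \<in> Obj A" "e \<in> Arr A" "Dom A e = Y" "Cod A e = FO F Y"
    "g \<in> Arr A" "Dom A g = X" "Cod A g = Y"
    using x y g by (auto simp: comod_obj hom_iff)
  note [simp] = cointegral_facts[OF \<theta>]
  \<comment> \<open>The arbitrary tail \<open>r\<close> lets the equation rewrite inside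
    right-nested composites; the same device recurs below.\<close>
  have 1: "e \<cdot> \<theta> Y \<cdot> r = \<theta> (FO F Y) \<cdot> FA F (FA F e) \<cdot> r"
    if "r \<in> Arr A" "Cod A r = FO F (FO F Y)" for r
    using that arg_cong[OF cointegral_nat[OF \<theta>, of e], of "\<lambda>t. t \<cdot> r"] by simp
  have 2: "FA F (FA F e) \<cdot> FA F e \<cdot> r = FA F (\<delta> Y) \<cdot> FA F e \<cdot> r"
    if "r \<in> Arr A" "Cod A r = FO F Y" for r
  proof -
    have "FA F (FA F e \<cdot> e) \<cdot> r = FA F (\<delta> Y \<cdot> e) \<cdot> r" using y by (simp add: comod_obj)
    then show ?thesis using that by simp
  qed
  have 3: "\<theta> (FO F Y) \<cdot> FA F (\<delta> Y) \<cdot> r = FA F (\<theta> Y) \<cdot> \<delta> (FO F Y) \<cdot> r"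
    if "r \<in> Arr A" "Cod A r = FO F (FO F Y)" for r
    using that arg_cong[OF cointegral_balanced[OF \<theta>, of Y], of "\<lambda>t. t \<cdot> r"] by simp
  have 4: "\<delta> (FO F Y) \<cdot> FA F (e \<cdot> g) = FA F (FA F (e \<cdot> g)) \<cdot> \<delta> X"
    using naturality_\<delta>[of "e \<cdot> g"] by simp
  have "e \<cdot> \<theta> Y \<cdot> FA F e \<cdot> FA F g \<cdot> d = \<theta> (FO F Y) \<cdot> FA F (\<delta> Y) \<cdot> FA F e \<cdot> FA F g \<cdot> d"
    by (simp add: 1 2)
  also have "\<dots> = FA F (\<theta> Y) \<cdot> \<delta> (FO F Y) \<cdot> FA F e \<cdot> FA F g \<cdot> d" by (simp add: 3)
  also have "\<dots> = FA F (\<theta> Y) \<cdot> (\<delta> (FO F Y) \<cdot> FA F (e \<cdot> g)) \<cdot> d" by simp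
  also have "\<dots> = FA F (\<theta> Y) \<cdot> FA F (FA F (e \<cdot> g)) \<cdot> \<delta> X \<cdot> d" unfolding 4 by simp
  also have "\<dots> = FA F (\<theta> Y) \<cdot> FA F (FA F (e \<cdot> g)) \<cdot> FA F d \<cdot> d" using x by (simp add: comod_obj)
  also have "\<dots> = FA F (\<theta> Y \<cdot> FA F e \<cdot> FA F g \<cdot> d) \<cdot> d" by simp
  finally show ?thesis using x y by (simp add: comod_arr)
qed

text \<open>On a colinear \<open>f'\<close> the average contains
  \<open>F e \<circ> e = \<delta> \<circ> e\<close>, and
  \<open>\<theta> \<circ> \<delta> = \<xi>\<close> reduces it to \<open>f'\<close>. Averaging is
  natural in the source by colinearity of \<open>a'\<close>, and in the target by colinearity of
  \<open>b'\<close> and naturality of \<open>\<theta>\<close>.\<close>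

lemma separable_of_cointegral:
  assumes \<theta>: "cointegral \<theta>"
  shows "separable_functor (comod_cat A F \<delta> \<xi>) A (forget_comod A F \<delta> \<xi>)"
  unfolding separable_functor_def
proof (intro exI conjI ballI; clarify?)
  \<comment> \<open>The witness for separability: the averaged arrow, packed with its endpoints as
    an arrow of the comodule category.\<close>
  let ?P = "\<lambda>x y g. (x, \<theta> (fst y) \<cdot> FA F (snd y) \<cdot> FA F g \<cdot> snd x, y)"
  note [simp] = cointegral_facts[OF \<theta>]
  fix X d Y e
  assume x: "(X, d) \<in> Obj (comod_cat A F \<delta> \<xi>)" and y: "(Y, e) \<in> Obj (comod_cat A F \<delta> \<xi>)"
  have [simp]: "X \<in> Obj A" "d \<in> Arr A" "Dom A d = X" "Cod A d = FO F X"
    "Y \<in> Obj A" "e \<in> Arr A" "Dom A e = Y" "Cod A e = FO F Y"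
    using x y by (auto simp: comod_obj)
  show "?P (X, d) (Y, e) g \<in> hom_set (comod_cat A F \<delta> \<xi>) (X, d) (Y, e)"
    if "g \<in> hom_set A (FO (forget_comod A F \<delta> \<xi>) (X, d)) (FO (forget_comod A F \<delta> \<xi>) (Y, e))" for g
    using comod_average_colinear[OF \<theta> x y] that x y by (simp add: comod_hom)
  show "?P (X, d) (Y, e) (FA (forget_comod A F \<delta> \<xi>) f) = f"
    if "f \<in> hom_set (comod_cat A F \<delta> \<xi>) (X, d) (Y, e)" for f
  proof -
    obtain f' where f: "f = ((X, d), f', (Y, e))" and arr: "((X, d), f', (Y, e)) \<in> Arr (comod_cat A F \<delta> \<xi>)"
      using \<open>f \<in> _\<close> by (auto simp: comod_hom)
    then have [simp]: "f' \<in> Arr A" "Dom A f' = X" "Cod A f' = Y" "FA F f' \<cdot> d = e \<cdot> f'"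
      by (auto simp: comod_arr)
    have "\<theta> Y \<cdot> FA F e \<cdot> FA F f' \<cdot> d = \<theta> Y \<cdot> (FA F e \<cdot> e) \<cdot> f'" by simp
    also have "FA F e \<cdot> e = \<delta> Y \<cdot> e" using y by (simp add: comod_obj)
    also have "\<theta> Y \<cdot> (\<delta> Y \<cdot> e) \<cdot> f' = (\<theta> Y \<cdot> \<delta> Y) \<cdot> e \<cdot> f'" by simp
    also have "\<dots> = (\<xi> Y \<cdot> e) \<cdot> f'" by (simp add: cointegral_\<delta>[OF \<theta>])
    also have "\<dots> = f'" using y by (simp add: comod_obj)
    finally show ?thesis using arr f by simp
  qed
  fix X' d' Y' e' a b g
  assume x': "(X', d') \<in> Obj (comod_cat A F \<delta> \<xi>)" and y': "(Y', e') \<in> Obj (comod_cat A F \<delta> \<xi>)"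
    and a: "a \<in> hom_set (comod_cat A F \<delta> \<xi>) (X', d') (X, d)"
    and b: "b \<in> hom_set (comod_cat A F \<delta> \<xi>) (Y, e) (Y', e')"
    and g: "g \<in> hom_set A (FO (forget_comod A F \<delta> \<xi>) (X, d)) (FO (forget_comod A F \<delta> \<xi>) (Y, e))"
  obtain a' b' where a': "a = ((X', d'), a', (X, d))" "((X', d'), a', (X, d)) \<in> Arr (comod_cat A F \<delta> \<xi>)"
    and b': "b = ((Y, e), b', (Y', e'))" "((Y, e), b', (Y', e')) \<in> Arr (comod_cat A F \<delta> \<xi>)"
    using a b by (auto simp: comod_hom)
  have [simp]: "a' \<in> Arr A" "Dom A a' = X'" "Cod A a' = X" "FA F a' \<cdot> d' = d \<cdot> a'"
    "b' \<in> Arr A" "Dom A b' = Y" "Cod A b' = Y'" "g \<in> Arr A" "Dom A g = X" "Cod A g = Y"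
    "X' \<in> Obj A" "d' \<in> Arr A" "Dom A d' = X'" "Cod A d' = FO F X'"
    "Y' \<in> Obj A" "e' \<in> Arr A" "Dom A e' = Y'" "Cod A e' = FO F Y'"
    using a' b' x y x' y' g by (auto simp: comod_arr comod_obj hom_iff)
  have "\<theta> Y' \<cdot> FA F e' \<cdot> FA F (b' \<cdot> g \<cdot> a') \<cdot> d' = \<theta> Y' \<cdot> FA F (e' \<cdot> b') \<cdot> FA F g \<cdot> d \<cdot> a'"
    by simp
  also have "e' \<cdot> b' = FA F b' \<cdot> e" using b' by (simp add: comod_arr)
  also have "\<theta> Y' \<cdot> FA F (FA F b' \<cdot> e) \<cdot> FA F g \<cdot> d \<cdot> a' =
      (\<theta> Y' \<cdot> FA F (FA F b')) \<cdot> FA F e \<cdot> FA F g \<cdot> d \<cdot> a'" by simp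
  also have "\<theta> Y' \<cdot> FA F (FA F b') = b' \<cdot> \<theta> Y" using cointegral_nat[OF \<theta>, of b'] by simp
  finally show "?P (X', d') (Y', e')
      (FA (forget_comod A F \<delta> \<xi>) b \<cdot> g \<cdot> FA (forget_comod A F \<delta> \<xi>) a) =
      b \<cdot>\<^bsub>comod_cat A F \<delta> \<xi>\<^esub> ?P (X, d) (Y, e) g \<cdot>\<^bsub>comod_cat A F \<delta> \<xi>\<^esub> a"
    using a' b' by simp
qed

section \<open>From separability to a bicolinear retraction\<close>

text \<open>The unit \<open>(X, d) \<rightarrow> (F X, \<delta> X)\<close> of the adjunction between the forgetful and the cofree functor has
  underlying arrow \<open>d\<close>. The separability structure turns the counit \<open>\<xi>\<close> into a natural retraction
  of it.\<close>

lemma unit_retraction_of_separable: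
  assumes "separable_functor (comod_cat A F \<delta> \<xi>) A (forget_comod A F \<delta> \<xi>)"
  obtains \<rho> where
    "\<And>X d. (X, d) \<in> Obj (comod_cat A F \<delta> \<xi>) \<Longrightarrow>
      ((FO F X, \<delta> X), \<rho> (X, d), (X, d)) \<in> Arr (comod_cat A F \<delta> \<xi>)"
    "\<And>X d. (X, d) \<in> Obj (comod_cat A F \<delta> \<xi>) \<Longrightarrow> \<rho> (X, d) \<cdot> d = Ide A X"
    "\<And>x f y. (x, f, y) \<in> Arr (comod_cat A F \<delta> \<xi>) \<Longrightarrow> f \<cdot> \<rho> x = \<rho> y \<cdot> FA F f"
proof -
  let ?C = "comod_cat A F \<delta> \<xi>" and ?S = "forget_comod A F \<delta> \<xi>"
  obtain P where
    hom: "\<forall>x\<in>Obj ?C. \<forall>y\<in>Obj ?C. \<forall>g\<in>hom_set A (FO ?S x) (FO ?S y). P x y g \<in> hom_set ?C x y"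
    and nat: "\<forall>x\<in>Obj ?C. \<forall>y\<in>Obj ?C. \<forall>x'\<in>Obj ?C. \<forall>y'\<in>Obj ?C.
      \<forall>a\<in>hom_set ?C x' x. \<forall>b\<in>hom_set ?C y y'. \<forall>g\<in>hom_set A (FO ?S x) (FO ?S y).
        P x' y' (FA ?S b \<cdot> g \<cdot> FA ?S a) = b \<cdot>\<^bsub>?C\<^esub> P x y g \<cdot>\<^bsub>?C\<^esub> a"
    and retr: "\<forall>x\<in>Obj ?C. \<forall>y\<in>Obj ?C. \<forall>f\<in>hom_set ?C x y. P x y (FA ?S f) = f"
    using assms unfolding separable_functor_def by (elim exE conjE)
  note P_hom = hom[rule_format] and P_nat = nat[rule_format] and P_retr = retr[rule_format]
  \<comment> \<open>\<open>K x\<close> is the cofree comodule on the underlying object of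
    \<open>x\<close>. The counit is an arrow between the underlying objects of \<open>K x\<close>
    and \<open>x\<close>; \<open>R x\<close> is its colinear replacement under \<open>P\<close>, and
    \<open>\<rho> x\<close> the arrow beneath it.\<close>
  define K where "K x = (FO F (fst x), \<delta> (fst x))" for x :: "'o \<times> 'a"
  define R where "R x = P (K x) x (\<xi> (fst x))" for x
  define \<rho> where "\<rho> x = fst (snd (R x))" for x
  have fst_obj [simp]: "fst x \<in> Obj A" if "x \<in> Obj ?C" for x
    using that by (cases x) (simp add: comod_obj)
  have K [simp]: "K x \<in> Obj ?C" "fst (K x) = FO F (fst x)" "snd (K x) = \<delta> (fst x)"
    if "x \<in> Obj ?C" for x
    using that by (simp_all add: K_def cofree_comod)
  have \<xi>_hom: "\<xi> (fst x) \<in> hom_set A (FO ?S (K x)) (FO ?S x)" if "x \<in> Obj ?C" for x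
    using that by (simp add: hom_iff)
  have R: "R x = (K x, \<rho> x, x)" "(K x, \<rho> x, x) \<in> Arr ?C" if "x \<in> Obj ?C" for x
    using P_hom[OF K(1) _ \<xi>_hom, OF that that that] that by (auto simp: R_def \<rho>_def comod_hom)
  have ide: "(x, Ide A (fst x), x) \<in> Arr ?C" if "x \<in> Obj ?C" for x
    using that by (cases x) (simp add: comod_arr comod_obj)
  have natural: "f \<cdot> \<rho> x = \<rho> y \<cdot> FA F f" if f: "(x, f, y) \<in> Arr ?C" for x f y
  proof -
    have xy [simp]: "x \<in> Obj ?C" "y \<in> Obj ?C" "f \<in> Arr A" "Dom A f = fst x" "Cod A f = fst y"
      using f by (auto simp: comod_arr)
    have Ff: "(K x, FA F f, K y) \<in> Arr ?C"
      using naturality_\<delta>[of f] by (simp add: comod_arr)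
    have [simp]: "\<rho> x \<in> Arr A" "Dom A (\<rho> x) = FO F (fst x)" "Cod A (\<rho> x) = fst x"
      "\<rho> y \<in> Arr A" "Dom A (\<rho> y) = FO F (fst y)" "Cod A (\<rho> y) = fst y"
      using R(2)[OF xy(1)] R(2)[OF xy(2)] by (auto simp: comod_arr)
    \<comment> \<open>Naturality of \<open>P\<close> is used once in the target along
      \<open>f\<close> and once in the source along \<open>F f\<close>, with an identity on the
      other side. Naturality of \<open>\<xi>\<close> makes the two arguments of \<open>P\<close>
      equal.\<close>
    have "P (K x) y (f \<cdot> \<xi> (fst x) \<cdot> Ide A (FO F (fst x))) = (K x, f \<cdot> \<rho> x, y)"
      using P_nat[of "K x" x "K x" y "(K x, Ide A (FO F (fst x)), K x)" "(x, f, y)" "\<xi> (fst x)"]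
        f R(1)[of x] ide[OF K(1), of x] \<xi>_hom[of x] by (simp add: comod_hom R_def[symmetric])
    moreover have "P (K x) y (Ide A (fst y) \<cdot> \<xi> (fst y) \<cdot> FA F f) = (K x, \<rho> y \<cdot> FA F f, y)"
      using P_nat[of "K y" y "K x" y "(K x, FA F f, K y)" "(y, Ide A (fst y), y)" "\<xi> (fst y)"]
        Ff R(1)[of y] ide[of y] \<xi>_hom[of y] by (simp add: comod_hom R_def[symmetric])
    moreover have "\<xi> (fst y) \<cdot> FA F f = f \<cdot> \<xi> (fst x)" using naturality_\<xi>[of f] by simp
    ultimately show ?thesis by simp
  qed
  show thesis
  proof (rule that)
    fix X d assume x: "(X, d) \<in> Obj ?C"
    then show "((FO F X, \<delta> X), \<rho> (X, d), (X, d)) \<in> Arr ?C"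
      using R(2)[OF x] by (simp add: K_def)
    \<comment> \<open>The coaction is itself colinear into the cofree comodule, by its
      coassociativity. Pulling \<open>P\<close> back along it turns \<open>\<xi> X\<close> into
      \<open>\<xi> X \<cdot> d\<close>, an identity, which \<open>P\<close> preserves.\<close>
    have d: "((X, d), d, K (X, d)) \<in> Arr ?C"
      using x by (simp add: comod_arr comod_obj)
    have [simp]: "d \<in> Arr A" "Dom A d = X" "Cod A d = FO F X" "X \<in> Obj A" "\<xi> X \<cdot> d = Ide A X"
      using x by (auto simp: comod_obj)
    have [simp]: "\<rho> (X, d) \<in> Arr A" "Dom A (\<rho> (X, d)) = FO F X" "Cod A (\<rho> (X, d)) = X"
      using R(2)[OF x] x by (auto simp: comod_arr)
    have "P (X, d) (X, d) (Ide A X \<cdot> \<xi> X \<cdot> d) = ((X, d), \<rho> (X, d) \<cdot> d, (X, d))"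
      using P_nat[of "K (X, d)" "(X, d)" "(X, d)" "(X, d)" "((X, d), d, K (X, d))"
          "((X, d), Ide A X, (X, d))" "\<xi> X"]
        R(1)[OF x, unfolded R_def] d ide[OF x] x \<xi>_hom[OF x] by (simp add: comod_hom)
    moreover have "P (X, d) (X, d) (Ide A X) = ((X, d), Ide A X, (X, d))"
      using P_retr[OF x x, of "((X, d), Ide A X, (X, d))"] ide[OF x] by (simp add: comod_hom)
    ultimately show "\<rho> (X, d) \<cdot> d = Ide A X" by simp
  qed (rule natural)
qed

text \<open>Evaluates \<open>\<rho>\<close> at cofree comodules. Left colinearity of
  \<open>\<gamma>\<close> is colinearity of \<open>\<rho>\<close>; right colinearity is naturality
  of \<open>\<rho>\<close> along \<open>\<delta> X\<close>, which is colinear between cofree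
  comodules by coassociativity.\<close>

lemma retraction_of_separable:
  assumes "separable_functor (comod_cat A F \<delta> \<xi>) A (forget_comod A F \<delta> \<xi>)"
  shows "\<exists>\<gamma>. bicolinear_retraction \<gamma>"
proof -
  let ?C = "comod_cat A F \<delta> \<xi>"
  obtain \<rho> where arr: "\<And>X d. (X, d) \<in> Obj ?C \<Longrightarrow> ((FO F X, \<delta> X), \<rho> (X, d), (X, d)) \<in> Arr ?C"
    and retr: "\<And>X d. (X, d) \<in> Obj ?C \<Longrightarrow> \<rho> (X, d) \<cdot> d = Ide A X"
    and nat: "\<And>x f y. (x, f, y) \<in> Arr ?C \<Longrightarrow> f \<cdot> \<rho> x = \<rho> y \<cdot> FA F f"
    using unit_retraction_of_separable[OF assms] by metis
  define \<gamma> where "\<gamma> = (\<lambda>X\<in>Obj A. \<rho> (FO F X, \<delta> X))"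
  have \<gamma>: "\<gamma> X \<in> hom_set A (FO F (FO F X)) (FO F X)"
    "\<delta> X \<cdot> \<gamma> X = FA F (\<gamma> X) \<cdot> \<delta> (FO F X)" "\<gamma> X \<cdot> \<delta> X = Ide A (FO F X)" if "X \<in> Obj A" for X
    using arr[OF cofree_comod[OF that]] retr[OF cofree_comod[OF that]] that
    by (auto simp: \<gamma>_def comod_arr hom_iff)
  have natural: "FA F f \<cdot> \<gamma> (Dom A f) = \<gamma> (Cod A f) \<cdot> FA F (FA F f)" if "f \<in> Arr A" for f
    using nat[of "(FO F (Dom A f), \<delta> (Dom A f))" "FA F f" "(FO F (Cod A f), \<delta> (Cod A f))"]
      that naturality_\<delta>[OF that] by (simp add: \<gamma>_def comod_arr cofree_comod)
  have "\<delta> X \<cdot> \<gamma> X = \<gamma> (FO F X) \<cdot> FA F (\<delta> X)" if "X \<in> Obj A" for X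
    using nat[of "(FO F X, \<delta> X)" "\<delta> X" "(FO F (FO F X), \<delta> (FO F X))"] that coassoc[OF that]
    by (simp add: \<gamma>_def comod_arr cofree_comod)
  moreover have "\<gamma> \<in> extensional (Obj A)" by (simp add: \<gamma>_def)
  ultimately have "bicolinear_retraction \<gamma>"
    using \<gamma> natural by (simp add: bicolinear_retraction_def nat_trans_iff)
  then show ?thesis by blast
qed

end
section \<open>Bicomodules\<close>

locale bicomodule_category = preadditive_category A + comonad_category A F \<delta> \<xi>
  for A :: "('o, 'a, 'z) addcat_scheme" (structure)
    and F :: "('o, 'a, 'o, 'a) funct" and \<delta> \<xi> :: "'o \<Rightarrow> 'a" +
  fixes U :: "'u set"
  assumes F_Funt: "F \<in> Funt U A"
begin

lemma left_comod_iff: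
  "is_left_comod U A F \<delta> \<xi> M m \<longleftrightarrow> M \<in> Funt U A \<and> nat_trans A A M (comp_funct A F M) m \<and>
    (\<forall>X\<in>Obj A. \<delta> (FO M X) \<cdot> m X = FA F (m X) \<cdot> m X \<and> \<xi> (FO M X) \<cdot> m X = Ide A (FO M X))"
  by (auto simp: is_left_comod_def vcomp_eq_iff)

lemma bicomod_iff:
  "is_bicomod U A F \<delta> \<xi> M m n \<longleftrightarrow> is_left_comod U A F \<delta> \<xi> M m \<and>
    nat_trans A A M (comp_funct A M F) n \<and>
    (\<forall>X\<in>Obj A. FA M (\<delta> X) \<cdot> n X = n (FO F X) \<cdot> n X \<and> FA M (\<xi> X) \<cdot> n X = Ide A (FO M X) \<and>
      m (FO F X) \<cdot> n X = FA F (n X) \<cdot> m X)"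
  by (auto simp: is_bicomod_def vcomp_eq_iff)

section \<open>Colinear transformations and componentwise laws of bicomodules\<close>

definition left_colinear :: "('o \<Rightarrow> 'a) \<Rightarrow> ('o \<Rightarrow> 'a) \<Rightarrow> ('o \<Rightarrow> 'a) \<Rightarrow> bool" where
  "left_colinear m m' f \<longleftrightarrow> (\<forall>X\<in>Obj A. m' X \<cdot> f X = FA F (f X) \<cdot> m X)"

definition right_colinear :: "('o \<Rightarrow> 'a) \<Rightarrow> ('o \<Rightarrow> 'a) \<Rightarrow> ('o \<Rightarrow> 'a) \<Rightarrow> bool" where
  "right_colinear n n' f \<longleftrightarrow> (\<forall>X\<in>Obj A. n' X \<cdot> f X = f (FO F X) \<cdot> n X)"

lemma hom_bicomod_cat:
  "hom_set (bicomod_cat U A F \<delta> \<xi>) (M, m, n) (M', m', n') =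
    {((M, m, n), f, (M', m', n')) | f. is_bicomod U A F \<delta> \<xi> M m n \<and> is_bicomod U A F \<delta> \<xi> M' m' n' \<and>
      nat_trans A A M M' f \<and> left_colinear m m' f \<and> right_colinear n n' f}"
  unfolding bicomod_cat_def hom_cat_of
  by (auto simp: vcomp_eq_iff left_colinear_def right_colinear_def)

lemma bicomod_cat_simps [simp]:
  "(M, m, n) \<in> Obj (bicomod_cat U A F \<delta> \<xi>) \<longleftrightarrow> is_bicomod U A F \<delta> \<xi> M m n"
  "Comp (bicomod_cat U A F \<delta> \<xi>) (y, g, z) (x, f, y') = (x, vcomp A A g f, z)"
  by (simp_all add: bicomod_cat_def)

lemma forget_bicomod_arr:
  assumes "((M, m, n), f, (M', m', n')) \<in> hom_set (bicomod_cat U A F \<delta> \<xi>) (M, m, n) (M', m', n')"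
  shows "FA (forget_bicomod U A F \<delta> \<xi>) ((M, m, n), f, (M', m', n')) = ((M, m), f, (M', m'))"
  using assms by (simp add: forget_bicomod_def hom_set_def)

lemma split_mono_left_comod_cat:
  "split_mono (left_comod_cat U A F \<delta> \<xi>) ((M, m), f, (M', m')) \<longleftrightarrow>
    is_left_comod U A F \<delta> \<xi> M m \<and> is_left_comod U A F \<delta> \<xi> M' m' \<and>
    nat_trans A A M M' f \<and> left_colinear m m' f \<and>
    (\<exists>g. nat_trans A A M' M g \<and> left_colinear m' m g \<and> vcomp A A g f = id_trans A A M)"
  unfolding left_comod_cat_def split_mono_cat_of
  by (auto simp: vcomp_eq_iff left_colinear_def)

lemma split_mono_bicomod_cat:
  "split_mono (bicomod_cat U A F \<delta> \<xi>) ((M, m, n), f, (M', m', n')) \<longleftrightarrow>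
    is_bicomod U A F \<delta> \<xi> M m n \<and> is_bicomod U A F \<delta> \<xi> M' m' n' \<and>
    nat_trans A A M M' f \<and> left_colinear m m' f \<and> right_colinear n n' f \<and>
    (\<exists>g. nat_trans A A M' M g \<and> left_colinear m' m g \<and> right_colinear n' n g \<and>
      vcomp A A g f = id_trans A A M)"
  unfolding bicomod_cat_def split_mono_cat_of
  by (auto simp: vcomp_eq_iff left_colinear_def right_colinear_def)

lemma bicomod_facts:
  assumes "is_bicomod U A F \<delta> \<xi> M m n"
  shows "is_functor A A M"
    and "nat_trans A A M (comp_funct A F M) m"
    and "nat_trans A A M (comp_funct A M F) n"
  using assms by (auto simp: bicomod_iff left_comod_iff Funt_def additive_functor_def)

lemma bicomod_arr:
  assumes M: "is_bicomod U A F \<delta> \<xi> M m n" and X: "X \<in> Obj A"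
  shows "m X \<in> Arr A" "Dom A (m X) = FO M X" "Cod A (m X) = FO F (FO M X)"
    and "n X \<in> Arr A" "Dom A (n X) = FO M X" "Cod A (n X) = FO M (FO F X)"
  using nat_trans_facts[OF bicomod_facts(2)[OF M] X] nat_trans_facts[OF bicomod_facts(3)[OF M] X] X
  by simp_all

lemma bicomod_natural:
  assumes M: "is_bicomod U A F \<delta> \<xi> M m n" and f: "f \<in> Arr A"
  shows "m (Cod A f) \<cdot> FA M f = FA F (FA M f) \<cdot> m (Dom A f)"
    and "n (Cod A f) \<cdot> FA M f = FA M (FA F f) \<cdot> n (Dom A f)"
  using naturality[OF bicomod_facts(2)[OF M] f] naturality[OF bicomod_facts(3)[OF M] f] f
  by simp_all

lemma bicomod_laws:
  assumes M: "is_bicomod U A F \<delta> \<xi> M m n" and X: "X \<in> Obj A"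
  shows "FA M (\<delta> X) \<cdot> n X = n (FO F X) \<cdot> n X" "FA M (\<xi> X) \<cdot> n X = Ide A (FO M X)"
    and "m (FO F X) \<cdot> n X = FA F (n X) \<cdot> m X"
  using assms by (auto simp: bicomod_iff)

section \<open>Averaging of transformations between bicomodules\<close>

text \<open>The composite runs through \<open>M X\<close>, \<open>M(F X)\<close>,
  \<open>N(F X)\<close>, \<open>N(F(F X))\<close> and \<open>N X\<close>. Restriction to
  \<open>Obj A\<close> supplies the extensionality that \<open>nat_trans\<close> demands.\<close>

definition average ::
  "('o \<Rightarrow> 'a) \<Rightarrow> ('o, 'a, 'o, 'a) funct \<Rightarrow> ('o \<Rightarrow> 'a) \<Rightarrow> ('o \<Rightarrow> 'a) \<Rightarrow> ('o \<Rightarrow> 'a) \<Rightarrow> 'o \<Rightarrow> 'a" where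
  "average \<theta> N n q h = (\<lambda>X\<in>Obj A. FA N (\<theta> X) \<cdot> q (FO F X) \<cdot> h (FO F X) \<cdot> n X)"

context
  fixes \<theta> M m n N p q h
  assumes \<theta>: "cointegral \<theta>"
    and M: "is_bicomod U A F \<delta> \<xi> M m n" and N: "is_bicomod U A F \<delta> \<xi> N p q"
    and h: "nat_trans A A M N h"
begin

lemmas average_simps = bicomod_facts(1)[OF M] bicomod_facts(1)[OF N] bicomod_arr[OF M]
  bicomod_arr[OF N] nat_trans_facts[OF h] cointegral_facts[OF \<theta>]

text \<open>The arrow \<open>f\<close> is pushed through the four factors in turn, by naturality of
  \<open>\<theta>\<close>, \<open>q\<close>, \<open>h\<close> and \<open>n\<close>.\<close>

lemma nat_trans_average: "nat_trans A A M N (average \<theta> N n q h)"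
proof -
  note [simp] = average_simps
  have "FA N f \<cdot> average \<theta> N n q h (Dom A f) = average \<theta> N n q h (Cod A f) \<cdot> FA M f"
    if [simp]: "f \<in> Arr A" for f
  proof -
    let ?X = "Dom A f" and ?Y = "Cod A f"
    have 1: "FA N f \<cdot> FA N (\<theta> ?X) \<cdot> r = FA N (\<theta> ?Y) \<cdot> FA N (FA F (FA F f)) \<cdot> r"
      if "r \<in> Arr A" "Cod A r = FO N (FO F (FO F ?X))" for r
      using that arg_cong[OF cointegral_nat[OF \<theta>, of f], of "\<lambda>t. FA N t \<cdot> r"] by simp
    have 2: "FA N (FA F (FA F f)) \<cdot> q (FO F ?X) \<cdot> r = q (FO F ?Y) \<cdot> FA N (FA F f) \<cdot> r"
      if "r \<in> Arr A" "Cod A r = FO N (FO F ?X)" for r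
      using that arg_cong[OF bicomod_natural(2)[OF N, of "FA F f"], of "\<lambda>t. t \<cdot> r"] by simp
    have 3: "FA N (FA F f) \<cdot> h (FO F ?X) \<cdot> r = h (FO F ?Y) \<cdot> FA M (FA F f) \<cdot> r"
      if "r \<in> Arr A" "Cod A r = FO M (FO F ?X)" for r
      using that arg_cong[OF naturality[OF h, of "FA F f" "FO F ?X" "FO F ?Y"], of "\<lambda>t. t \<cdot> r"] by simp
    show ?thesis
      using bicomod_natural(2)[OF M, of f] by (simp add: average_def 1 2 3)
  qed
  then show ?thesis by (simp add: nat_trans_iff hom_iff) (simp add: average_def)
qed

text \<open>The coaction \<open>p\<close> passes \<open>N\<theta>\<close> by naturality,
  \<open>q\<close> by the compatibility law of \<open>N\<close>, and \<open>h\<close> by left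
  colinearity, where it becomes \<open>m\<close>; the compatibility law of \<open>M\<close> takes
  \<open>m\<close> past \<open>n\<close>.\<close>

lemma left_colinear_average:
  assumes "left_colinear m p h"
  shows "left_colinear m p (average \<theta> N n q h)"
  unfolding left_colinear_def
proof
  note [simp] = average_simps
  fix X assume [simp]: "X \<in> Obj A"
  have 1: "p X \<cdot> FA N (\<theta> X) \<cdot> r = FA F (FA N (\<theta> X)) \<cdot> p (FO F (FO F X)) \<cdot> r"
    if "r \<in> Arr A" "Cod A r = FO N (FO F (FO F X))" for r
    using that arg_cong[OF bicomod_natural(1)[OF N, of "\<theta> X"], of "\<lambda>t. t \<cdot> r"] by simp
  have 2: "p (FO F (FO F X)) \<cdot> q (FO F X) \<cdot> r = FA F (q (FO F X)) \<cdot> p (FO F X) \<cdot> r"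
    if "r \<in> Arr A" "Cod A r = FO N (FO F X)" for r
    using that arg_cong[OF bicomod_laws(3)[OF N, of "FO F X"], of "\<lambda>t. t \<cdot> r"] by simp
  have h_colinear: "p (FO F X) \<cdot> h (FO F X) = FA F (h (FO F X)) \<cdot> m (FO F X)"
    using assms by (simp add: left_colinear_def)
  have 3: "p (FO F X) \<cdot> h (FO F X) \<cdot> r = FA F (h (FO F X)) \<cdot> m (FO F X) \<cdot> r"
    if "r \<in> Arr A" "Cod A r = FO M (FO F X)" for r
    using that arg_cong[OF h_colinear, of "\<lambda>t. t \<cdot> r"] by simp
  show "p X \<cdot> average \<theta> N n q h X = FA F (average \<theta> N n q h X) \<cdot> m X"
    using bicomod_laws(3)[OF M, of X] by (simp add: average_def 1 2 3)
qed

text \<open>Valid for every natural \<open>h\<close>. Coassociativity of \<open>q\<close> produces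
  \<open>\<delta>\<^sub>F\<close>, and the balance condition trades
  \<open>F\<theta> \<circ> \<delta>\<^sub>F\<close> for
  \<open>\<theta>\<^sub>F \<circ> F\<delta>\<close>. The new \<open>\<delta>\<close> passes
  \<open>q\<close> and \<open>h\<close> by naturality and is absorbed by coassociativity of
  \<open>n\<close>.\<close>

lemma right_colinear_average: "right_colinear n q (average \<theta> N n q h)"
  unfolding right_colinear_def
proof
  note [simp] = average_simps
  fix X assume [simp]: "X \<in> Obj A"
  let ?FX = "FO F X" and ?FFX = "FO F (FO F X)"
  let ?r = "h ?FX \<cdot> n X"
  have "q X \<cdot> average \<theta> N n q h X = (q X \<cdot> FA N (\<theta> X)) \<cdot> q ?FX \<cdot> ?r" by (simp add: average_def)
  also have "\<dots> = FA N (FA F (\<theta> X)) \<cdot> (q ?FFX \<cdot> q ?FX) \<cdot> ?r"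
    using bicomod_natural(2)[OF N, of "\<theta> X"] by simp
  also have "\<dots> = FA N (FA F (\<theta> X) \<cdot> \<delta> ?FX) \<cdot> q ?FX \<cdot> ?r"
    by (simp flip: bicomod_laws(1)[OF N])
  also have "\<dots> = FA N (\<theta> ?FX) \<cdot> (FA N (FA F (\<delta> X)) \<cdot> q ?FX) \<cdot> ?r"
    unfolding cointegral_balanced[OF \<theta> \<open>X \<in> Obj A\<close>] by simp
  also have "FA N (FA F (\<delta> X)) \<cdot> q ?FX = q ?FFX \<cdot> FA N (\<delta> X)"
    using bicomod_natural(2)[OF N, of "\<delta> X"] by simp
  also have "FA N (\<theta> ?FX) \<cdot> (q ?FFX \<cdot> FA N (\<delta> X)) \<cdot> ?r =
      FA N (\<theta> ?FX) \<cdot> q ?FFX \<cdot> (FA N (\<delta> X) \<cdot> h ?FX) \<cdot> n X" by simp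
  also have "FA N (\<delta> X) \<cdot> h ?FX = h ?FFX \<cdot> FA M (\<delta> X)"
    using naturality[OF h, of "\<delta> X"] by simp
  also have "FA N (\<theta> ?FX) \<cdot> q ?FFX \<cdot> (h ?FFX \<cdot> FA M (\<delta> X)) \<cdot> n X = average \<theta> N n q h ?FX \<cdot> n X"
    by (simp add: average_def bicomod_laws(1)[OF M])
  finally show "q X \<cdot> average \<theta> N n q h X = average \<theta> N n q h ?FX \<cdot> n X" .
qed

text \<open>Right colinearity of \<open>i\<close> and \<open>f\<close> moves the coactions so that
  \<open>h \<circ> i = f\<close> applies at \<open>F X\<close>, leaving
  \<open>N\<theta> \<circ> q\<^sub>F \<circ> q \<circ> f\<close>. Coassociativity of
  \<open>q\<close> and \<open>\<theta> \<circ> \<delta> = \<xi>\<close> reduce this to the counit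
  law of \<open>q\<close>.\<close>

lemma average_extends:
  assumes L: "is_bicomod U A F \<delta> \<xi> L k l" and i: "nat_trans A A L M i" "right_colinear l n i"
    and f: "nat_trans A A L N f" "right_colinear l q f"
    and hi: "\<And>X. X \<in> Obj A \<Longrightarrow> h X \<cdot> i X = f X"
    and X [simp]: "X \<in> Obj A"
  shows "average \<theta> N n q h X \<cdot> i X = f X"
proof -
  note [simp] = average_simps bicomod_facts(1)[OF L] bicomod_arr[OF L] nat_trans_facts[OF i(1)]
    nat_trans_facts[OF f(1)]
  let ?FX = "FO F X"
  have "average \<theta> N n q h X \<cdot> i X = FA N (\<theta> X) \<cdot> q ?FX \<cdot> h ?FX \<cdot> n X \<cdot> i X"
    by (simp add: average_def)
  also have "n X \<cdot> i X = i ?FX \<cdot> l X" using i by (simp add: right_colinear_def)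
  also have "FA N (\<theta> X) \<cdot> q ?FX \<cdot> h ?FX \<cdot> i ?FX \<cdot> l X =
      FA N (\<theta> X) \<cdot> q ?FX \<cdot> (h ?FX \<cdot> i ?FX) \<cdot> l X" by simp
  also have "(h ?FX \<cdot> i ?FX) \<cdot> l X = q X \<cdot> f X"
    unfolding hi[OF endofunctor_simps(1)[OF functor_F X]]
    using f by (simp add: right_colinear_def)
  also have "FA N (\<theta> X) \<cdot> q ?FX \<cdot> q X \<cdot> f X = FA N (\<theta> X) \<cdot> (q ?FX \<cdot> q X) \<cdot> f X" by simp
  also have "\<dots> = FA N (\<theta> X \<cdot> \<delta> X) \<cdot> q X \<cdot> f X"
    unfolding bicomod_laws(1)[OF N X, symmetric] by simp
  also have "\<dots> = (FA N (\<xi> X) \<cdot> q X) \<cdot> f X" by (simp add: cointegral_\<delta>[OF \<theta>])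
  also have "\<dots> = f X" unfolding bicomod_laws(2)[OF N X] by simp
  finally show ?thesis .
qed

end

lemma maschke_of_cointegral:
  assumes \<theta>: "cointegral \<theta>"
  shows "maschke_functor (bicomod_cat U A F \<delta> \<xi>) (left_comod_cat U A F \<delta> \<xi>)
    (forget_bicomod U A F \<delta> \<xi>)"
  unfolding maschke_functor_def relative_injective_def
proof (intro ballI impI; clarify)
  let ?B = "bicomod_cat U A F \<delta> \<xi>"
  \<comment> \<open>Here \<open>N\<close> is the object tested for injectivity, \<open>i\<close>
    goes from \<open>L\<close> to \<open>M\<close> and \<open>f\<close> from \<open>L\<close> to
    \<open>N\<close>. The variables \<open>x\<close>, \<open>y\<close>, \<open>x'\<close>,
    \<open>z\<close> are the endpoints stored in the arrow triples.\<close>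
  fix N p q L k l M m n x i y x' f z
  assume N: "(N, p, q) \<in> Obj ?B" and L: "(L, k, l) \<in> Obj ?B" and M: "(M, m, n) \<in> Obj ?B"
    and i_hom: "(x, i, y) \<in> hom_set ?B (L, k, l) (M, m, n)"
    and split: "split_mono (left_comod_cat U A F \<delta> \<xi>) (FA (forget_bicomod U A F \<delta> \<xi>) (x, i, y))"
    and f_hom: "(x', f, z) \<in> hom_set ?B (L, k, l) (N, p, q)"
  have [simp]: "x = (L, k, l)" "y = (M, m, n)" "x' = (L, k, l)" "z = (N, p, q)"
    using i_hom f_hom by (auto simp: hom_bicomod_cat)
  have i: "nat_trans A A L M i" "left_colinear k m i" "right_colinear l n i"
    and f: "nat_trans A A L N f" "left_colinear k p f" "right_colinear l q f"
    using i_hom f_hom by (auto simp: hom_bicomod_cat)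
  have bicomod: "is_bicomod U A F \<delta> \<xi> N p q" "is_bicomod U A F \<delta> \<xi> L k l"
    "is_bicomod U A F \<delta> \<xi> M m n"
    using N L M by simp_all
  note [simp] = bicomod_facts(1)[OF bicomod(1)] bicomod_facts(1)[OF bicomod(2)]
    bicomod_facts(1)[OF bicomod(3)]
    bicomod_arr[OF bicomod(1)] bicomod_arr[OF bicomod(2)] bicomod_arr[OF bicomod(3)]
    nat_trans_facts[OF i(1)] nat_trans_facts[OF f(1)]
  have "split_mono (left_comod_cat U A F \<delta> \<xi>) ((L, k), i, (M, m))"
    using split forget_bicomod_arr i_hom by simp
  then obtain j where j: "nat_trans A A M L j" "left_colinear m k j" "vcomp A A j i = id_trans A A L"
    by (auto simp: split_mono_left_comod_cat)
  note [simp] = nat_trans_facts[OF j(1)]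
  have ji: "j X \<cdot> i X = Ide A (FO L X)" if "X \<in> Obj A" for X
    using j(3) that by (simp add: vcomp_eq_iff)
  \<comment> \<open>Composing with the left colinear retraction \<open>j\<close> already extends
    \<open>f\<close>, but only in the category of left comodules; averaging makes the extension
    right colinear as well.\<close>
  let ?h = "vcomp A A f j"
  have h: "nat_trans A A M N ?h"
  proof -
    have "FA N a \<cdot> f (Dom A a) \<cdot> j (Dom A a) = f (Cod A a) \<cdot> j (Cod A a) \<cdot> FA M a"
      if [simp]: "a \<in> Arr A" for a
    proof -
      have "FA N a \<cdot> f (Dom A a) \<cdot> j (Dom A a) = (FA N a \<cdot> f (Dom A a)) \<cdot> j (Dom A a)" by simp
      also have "\<dots> = f (Cod A a) \<cdot> FA L a \<cdot> j (Dom A a)" by (simp add: naturality[OF f(1), of a])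
      also have "\<dots> = f (Cod A a) \<cdot> j (Cod A a) \<cdot> FA M a" by (simp add: naturality[OF j(1), of a])
      finally show ?thesis .
    qed
    then show ?thesis by (simp add: nat_trans_iff hom_iff)
  qed
  have "left_colinear m p ?h"
    unfolding left_colinear_def
  proof
    fix X assume [simp]: "X \<in> Obj A"
    have "p X \<cdot> f X \<cdot> j X = (p X \<cdot> f X) \<cdot> j X" by simp
    also have "\<dots> = FA F (f X) \<cdot> k X \<cdot> j X" using f by (simp add: left_colinear_def)
    also have "\<dots> = FA F (f X) \<cdot> FA F (j X) \<cdot> m X" using j by (simp add: left_colinear_def)
    finally show "p X \<cdot> ?h X = FA F (?h X) \<cdot> m X" by simp
  qed
  note avg = nat_trans_average[OF \<theta> bicomod(3,1) h] right_colinear_average[OF \<theta> bicomod(3,1) h]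
    left_colinear_average[OF \<theta> bicomod(3,1) h this]
  let ?g = "average \<theta> N n q ?h"
  have "?g X \<cdot> i X = f X" if "X \<in> Obj A" for X
    using that by (intro average_extends[OF \<theta> bicomod(3,1) h bicomod(2) i(1,3) f(1,3)])
      (simp_all add: ji)
  moreover have "f \<in> extensional (Obj A)" using f by (simp add: nat_trans_iff)
  ultimately have "vcomp A A ?g i = f" by (simp add: vcomp_eq_iff)
  then show "\<exists>g\<in>hom_set ?B (M, m, n) (N, p, q). g \<cdot>\<^bsub>?B\<^esub> (x, i, y) = (x', f, z)"
    using avg bicomod by (intro bexI[of _ "((M, m, n), ?g, (N, p, q))"]) (auto simp: hom_bicomod_cat)
qed

section \<open>The bicomodules \<open>F\<close> and \<open>F\<^sup>2\<close> and the morphism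
  \<open>\<delta>\<close>\<close>

lemma bicomod_F: "is_bicomod U A F \<delta> \<xi> F \<delta> \<delta>"
  by (simp add: bicomod_iff left_comod_iff F_Funt nat_\<delta> coassoc counit_left counit_right)

text \<open>The left coaction laws are the comonad laws at \<open>F X\<close>, the right ones are
  the image of the comonad laws under \<open>F\<close>, and compatibility is naturality of
  \<open>\<delta>\<close> at the arrow \<open>\<delta> X\<close>.\<close>

lemma bicomod_FF:
  "is_bicomod U A F \<delta> \<xi> (comp_funct A F F) (whisker_right A \<delta> F) (whisker_left A F \<delta>)"
proof -
  have "FA F (FA F (\<delta> X)) \<cdot> FA F (\<delta> X) = FA F (\<delta> (FO F X)) \<cdot> FA F (\<delta> X)"
    "FA F (FA F (\<xi> X)) \<cdot> FA F (\<delta> X) = Ide A (FO F (FO F X))" if "X \<in> Obj A" for X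
    using that arg_cong[OF coassoc[OF that], of "FA F"] arg_cong[OF counit_left[OF that], of "FA F"]
    by simp_all
  moreover have "\<delta> (FO F (FO F X)) \<cdot> FA F (\<delta> X) = FA F (FA F (\<delta> X)) \<cdot> \<delta> (FO F X)"
    if "X \<in> Obj A" for X
    using that naturality_\<delta>[of "\<delta> X"] by simp
  moreover have "FA F (FA F (FA F f)) \<cdot> \<delta> (FO F (Dom A f)) = \<delta> (FO F (Cod A f)) \<cdot> FA F (FA F f)"
    "FA F (FA F (FA F f)) \<cdot> FA F (\<delta> (Dom A f)) = FA F (\<delta> (Cod A f)) \<cdot> FA F (FA F f)"
    if "f \<in> Arr A" for f
    using that naturality_\<delta>[of "FA F f"] arg_cong[OF naturality_\<delta>[OF that], of "FA F"] by simp_all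
  ultimately show ?thesis
    by (simp add: bicomod_iff left_comod_iff comp_funct_Funt F_Funt nat_trans_iff hom_iff
        coassoc counit_right)
qed

lemma \<delta>_colinear:
  "left_colinear \<delta> (whisker_right A \<delta> F) \<delta>" "right_colinear \<delta> (whisker_left A F \<delta>) \<delta>"
  by (simp_all add: left_colinear_def right_colinear_def coassoc)

lemma split_mono_\<delta>_iff:
  "split_mono (bicomod_cat U A F \<delta> \<xi>)
    ((F, \<delta>, \<delta>), \<delta>, (comp_funct A F F, whisker_right A \<delta> F, whisker_left A F \<delta>)) \<longleftrightarrow>
    (\<exists>\<gamma>. bicolinear_retraction \<gamma>)"
  unfolding split_mono_bicomod_cat bicolinear_retraction_def
  by (auto simp: bicomod_F bicomod_FF nat_\<delta> \<delta>_colinear vcomp_eq_iff left_colinear_def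
      right_colinear_def coassoc)

text \<open>Relative injectivity of \<open>F\<close> is applied to extending the identity of
  \<open>F\<close> along \<open>\<delta>\<close>; the extension is the retraction. The left inverse
  \<open>F\<xi>\<close> of \<open>\<delta>\<close> is left colinear by naturality of
  \<open>\<delta>\<close> at \<open>\<xi> X\<close>.\<close>

lemma retraction_of_maschke:
  assumes "maschke_functor (bicomod_cat U A F \<delta> \<xi>) (left_comod_cat U A F \<delta> \<xi>)
    (forget_bicomod U A F \<delta> \<xi>)"
  shows "\<exists>\<gamma>. bicolinear_retraction \<gamma>"
proof -
  let ?B = "bicomod_cat U A F \<delta> \<xi>"
  let ?x = "(F, \<delta>, \<delta>)" and ?y = "(comp_funct A F F, whisker_right A \<delta> F, whisker_left A F \<delta>)"
  have hom: "(?x, \<delta>, ?y) \<in> hom_set ?B ?x ?y"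
    by (simp add: hom_bicomod_cat bicomod_F bicomod_FF nat_\<delta> \<delta>_colinear)
  have ide: "(?x, id_trans A A F, ?x) \<in> hom_set ?B ?x ?x"
    by (simp add: hom_bicomod_cat bicomod_F nat_trans_iff hom_iff left_colinear_def
        right_colinear_def)
  have F\<xi>: "nat_trans A A (comp_funct A F F) F (whisker_left A F \<xi>)"
  proof -
    have "FA F f \<cdot> FA F (\<xi> (Dom A f)) = FA F (\<xi> (Cod A f)) \<cdot> FA F (FA F f)" if "f \<in> Arr A" for f
      using that arg_cong[OF naturality_\<xi>[OF that], of "FA F"] by simp
    then show ?thesis by (simp add: nat_trans_iff hom_iff)
  qed
  have "left_colinear (whisker_right A \<delta> F) \<delta> (whisker_left A F \<xi>)"
    unfolding left_colinear_def
  proof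
    fix X assume "X \<in> Obj A"
    then show "\<delta> X \<cdot> whisker_left A F \<xi> X =
        FA F (whisker_left A F \<xi> X) \<cdot> whisker_right A \<delta> F X"
      using naturality_\<delta>[of "\<xi> X"] by simp
  qed
  then have "split_mono (left_comod_cat U A F \<delta> \<xi>) (FA (forget_bicomod U A F \<delta> \<xi>) (?x, \<delta>, ?y))"
    unfolding forget_bicomod_arr[OF hom] split_mono_left_comod_cat
    using bicomod_F bicomod_FF nat_\<delta> \<delta>_colinear(1) F\<xi>
    by (auto simp: bicomod_iff vcomp_eq_iff counit_left intro!: exI[of _ "whisker_left A F \<xi>"])
  then obtain g where "g \<in> hom_set ?B ?y ?x" "g \<cdot>\<^bsub>?B\<^esub> (?x, \<delta>, ?y) = (?x, id_trans A A F, ?x)"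
    using assms hom ide bicomod_F bicomod_FF
    unfolding maschke_functor_def relative_injective_def by (metis bicomod_cat_simps(1))
  then show ?thesis
    unfolding split_mono_\<delta>_iff[symmetric] split_mono_bicomod_cat
    using bicomod_F bicomod_FF nat_\<delta> \<delta>_colinear by (auto simp: hom_bicomod_cat)
qed

end

section \<open>Equivalence of separability, the Maschke property and the splitting of
  \<open>\<delta>\<close>\<close>

theorem theorem1p6:
  fixes A :: "('o, 'a) addcat" and U :: "'u set"
    and F :: "('o, 'a, 'o, 'a) funct" and \<delta> \<xi> :: "'o \<Rightarrow> 'a"
  assumes "grothendieck_category A U"
    and "comonad A F \<delta> \<xi>"
    and "preserves_cokernels A A F"
    and "commutes_with_direct_sums U A A F"
  shows "(separable_functor (comod_cat A F \<delta> \<xi>) A (forget_comod A F \<delta> \<xi>) \<longleftrightarrow>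
      maschke_functor (bicomod_cat U A F \<delta> \<xi>) (left_comod_cat U A F \<delta> \<xi>) (forget_bicomod U A F \<delta> \<xi>)) \<and>
    (maschke_functor (bicomod_cat U A F \<delta> \<xi>) (left_comod_cat U A F \<delta> \<xi>) (forget_bicomod U A F \<delta> \<xi>) \<longleftrightarrow>
      split_mono (bicomod_cat U A F \<delta> \<xi>)
        ((F, \<delta>, \<delta>), \<delta>, (comp_funct A F F, whisker_right A \<delta> F, whisker_left A F \<delta>)))"
proof -
  interpret grothendieck_category A U by fact
  interpret bicomodule_category A F \<delta> \<xi> U
    by unfold_locales (use assms in \<open>auto simp: comonad_def Funt_def\<close>)
  \<comment> \<open>Each condition is equivalent to the existence of a bicolinear retraction: all
    three yield one, and conversely its cointegral gives separability and the Maschke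
    property.\<close>
  show ?thesis
    using retraction_of_separable retraction_of_maschke cointegral_of_retraction
      separable_of_cointegral maschke_of_cointegral split_mono_\<delta>_iff by blast
qed

end
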